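(* Let $M^n=(F^n,W^n,\alpha^n)$ be the balanced random assignment market with $|F^n|=|W^n|=n$ in which the entries of $\alpha^n$ are i.i.d. uniform on $[0,1]$, and let $(\mu^{F,n},u^{F,n},v^{F,n})$ be its firm-optimal core allocation. Then (1) $E\left[\sum_{i\in\{1,\dots,n\}} v^{F,n}_i\right]\le \log(n)$; and (2) $E\left[\sum_{i\in\{1,\dots,n\}} v^{F,n}_i\right]=\Omega(\log(n))$ as $n\to\infty$.
   Context: A market is $M^n=(F^n,W^n,\alpha^n)$, where $F^n$ is a finite set of firms, $W^n$ a finite set of workers (indexed $1,\dots,n$), and $\alpha^n$ is an $|F^n|\times|W^n|$ real matrix; $\alpha^n_{f,w}$ is the value produced by the pair $(f,w)$. The value of a coalition $S\subseteq F^n\cup W^n$ is $\mathrm{v}(S)=\max[\alpha^n_{i_1j_1}+\dots+\alpha^n_{i_lj_l}]$, the maximum over all choices of $2l$ distinct agents $i_1,\dots,i_l\in S\cap F^n$, $j_1,\dots,j_l\in S\cap W^n$, $l\le\min\{|S\cap F^n|,|S\cap W^n|\}$. An allocation is a triple $(\mu,u,v)$, where $\mu$ is a (one-to-one, possibly partial) matching of firms and workers, and $u=(u_f)_{f\in F^n}$ (profits) and $v=(v_w)_{w\in W^n}$ (salaries) are real payoff vectors. Utility is linear in money and transfers between any agents are allowed, so feasibility means $\sum_f u_f+\sum_w v_w=\sum_{f:\mu(f)\ne\emptyset}\alpha^n_{f,\mu(f)}$. It is a core allocation if no coalition can deviate and split its value so that all its members become strictly better off, i.e. $\sum_{f\in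 S\cap F^n}u_f+\sum_{w\in S\cap W^n}v_w\ge \mathrm{v}(S)$ for every coalition $S$. (Equivalently: $u,v\ge0$, $u_f+v_w\ge\alpha^n_{f,w}$ for all $f,w$, with equality for matched pairs, and unmatched agents get $0$.) It is a known fact (Shapley–Shubik) that there is a firm-optimal core allocation, in which every firm's profit is the largest, and every worker's salary the smallest, among all core allocations; its payoff vectors are unique. $\log$ is the natural logarithm. *)

theory Defs
  imports "HOL-Probability.Probability" "HOL-Library.Landau_Symbols"
begin

text \<open>
  A market is given by a finite set \<open>F\<close> of firms, a finite set \<open>W\<close> of workers and a matrix
  \<open>\<alpha>\<close>, of which only the entries \<open>\<alpha> f w\<close> with \<open>f \<in> F\<close> and \<open>w \<in> W\<close> matter.
  Likewise the payoffs \<open>u f\<close> and \<open>v w\<close> are only relevant on \<open>F\<close> and \<open>W\<close>.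
\<close>

text \<open>A partial one-to-one matching is the set of its matched pairs.\<close>

definition is_matching :: "'f set \<Rightarrow> 'w set \<Rightarrow> ('f \<times> 'w) set \<Rightarrow> bool" where
  "is_matching F W \<mu> \<longleftrightarrow> \<mu> \<subseteq> F \<times> W \<and> inj_on fst \<mu> \<and> inj_on snd \<mu>"

definition matching_value :: "('f \<Rightarrow> 'w \<Rightarrow> real) \<Rightarrow> ('f \<times> 'w) set \<Rightarrow> real" where
  "matching_value \<alpha> \<mu> = (\<Sum>(f, w)\<in>\<mu>. \<alpha> f w)"

text \<open>
  A coalition is represented by its set \<open>A\<close> of firms and its set \<open>B\<close> of workers. A choice of
  \<open>2l\<close> distinct agents, paired up, is a matching with \<open>l\<close> pairs between \<open>A\<close> and \<open>B\<close>; the empty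
  choice \<open>l = 0\<close>, of value 0, is allowed, so the maximum is over a finite nonempty set.
\<close>

definition coalition_value :: "('f \<Rightarrow> 'w \<Rightarrow> real) \<Rightarrow> 'f set \<Rightarrow> 'w set \<Rightarrow> real" where
  "coalition_value \<alpha> A B = Max (matching_value \<alpha> ` {\<mu>. is_matching A B \<mu>})"

type_synonym ('f, 'w) allocation = "('f \<times> 'w) set \<times> ('f \<Rightarrow> real) \<times> ('w \<Rightarrow> real)"

definition feasible_allocation ::
  "'f set \<Rightarrow> 'w set \<Rightarrow> ('f \<Rightarrow> 'w \<Rightarrow> real) \<Rightarrow> ('f, 'w) allocation \<Rightarrow> bool" where
  "feasible_allocation F W \<alpha> = (\<lambda>(\<mu>, u, v).
     is_matching F W \<mu> \<and> (\<Sum>f\<in>F. u f) + (\<Sum>w\<in>W. v w) = matching_value \<alpha> \<mu>)"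

definition core_allocation ::
  "'f set \<Rightarrow> 'w set \<Rightarrow> ('f \<Rightarrow> 'w \<Rightarrow> real) \<Rightarrow> ('f, 'w) allocation \<Rightarrow> bool" where
  "core_allocation F W \<alpha> = (\<lambda>(\<mu>, u, v).
     feasible_allocation F W \<alpha> (\<mu>, u, v) \<and>
     (\<forall>A B. A \<subseteq> F \<and> B \<subseteq> W \<longrightarrow>
        (\<Sum>f\<in>A. u f) + (\<Sum>w\<in>B. v w) \<ge> coalition_value \<alpha> A B))"

definition firm_optimal_core_allocation ::
  "'f set \<Rightarrow> 'w set \<Rightarrow> ('f \<Rightarrow> 'w \<Rightarrow> real) \<Rightarrow> ('f, 'w) allocation \<Rightarrow> bool" where
  "firm_optimal_core_allocation F W \<alpha> = (\<lambda>(\<mu>, u, v).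
     core_allocation F W \<alpha> (\<mu>, u, v) \<and>
     (\<forall>\<mu>' u' v'. core_allocation F W \<alpha> (\<mu>', u', v') \<longrightarrow>
        (\<forall>f\<in>F. u' f \<le> u f) \<and> (\<forall>w\<in>W. v w \<le> v' w)))"

definition iid_uniform_matrix ::
  "'a measure \<Rightarrow> 'f set \<Rightarrow> 'w set \<Rightarrow> ('a \<Rightarrow> 'f \<Rightarrow> 'w \<Rightarrow> real) \<Rightarrow> bool" where
  "iid_uniform_matrix M F W \<alpha> \<longleftrightarrow>
     prob_space.indep_vars M (\<lambda>_. borel) (\<lambda>(f, w) \<omega>. \<alpha> \<omega> f w) (F \<times> W) \<and>
     (\<forall>f\<in>F. \<forall>w\<in>W. distr M borel (\<lambda>\<omega>. \<alpha> \<omega> f w) = uniform_measure lborel {0..1})"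

end

theory Submission
  imports Defs "HOL-Real_Asymp.Real_Asymp"
begin

text \<open>
  In the firm-optimal core allocation firm \<open>f\<close> earns its marginal value \<open>u f\<close>, so the total salary
  is the value of the market minus the sum of the marginal values. Adding \<open>j\<close> independent columns
  leaves the optimum unchanged iff every new entry in row \<open>f\<close> is at most \<open>u f\<close>, which has probability
  \<open>E Z ^ j\<close> for \<open>Z = (\<Prod>f. u f)\<close>; by exchangeability of the columns this probability is a quotient of
  binomial coefficients. So the moments of \<open>Z\<close> are known exactly, also for rectangular markets, and
  \<open>(\<Sum>f. 1 - u f) \<le> - ln Z\<close> has expectation at most the harmonic number \<open>H n\<close>. The upper bound follows
  since the optimal matching loses at least \<open>n / (n + 1)\<close> on average against the trivial bound \<open>n\<close>.
  Conversely this loss is at most 2, \<open>- ln Z\<close> exceeds \<open>ln n / 2\<close> with high probability, and all \<open>u f\<close>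
  are bounded away from 0 with high probability: by the upper bound most salaries are small, so a
  firm with a small profit would have small values with most workers. Hence \<open>(\<Sum>f. 1 - u f)\<close> is at
  least a constant times \<open>ln n\<close> in expectation.
\<close>

section \<open>Optimal matchings\<close>

text \<open>That the firm optimum pays marginal values needs salaries that support these profits;
  exchange arguments on matchings produce them, in place of linear programming duality. The
  criterion for new columns is an equivalence only up to ties, so it is proved in a strict and in a
  weak form, which have the same probability because the uniform law is continuous. For m firms and
  n \<ge> m workers the moments of \<open>Z\<close> are those of the Beta distribution with
  parameters n - m + 1 and m. Only moments are used: in the series of \<open>(1 - Z) ^ k / k\<close>
  for \<open>- ln Z\<close> each term has a known expectation, and these sum to at most H n - H (n -
  m). Rectangular markets are needed because the loss of the optimal matching is bounded by adding
  firms one at a time, each step costing at most (H n - H (n - m)) / m. The lower bound reverses 1 -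
  x \<le> - ln x up to a constant, which is possible only for x away from 0. A profit below d would
  force half of a row below 2 d; d = 1/128 makes this so rare that a union bound over all sets of
  workers and all firms still tends to 0.\<close>

definition injections :: "'f set \<Rightarrow> 'w set \<Rightarrow> ('f \<Rightarrow> 'w) set" where
  "injections A B = {\<sigma> \<in> A \<rightarrow>\<^sub>E B. inj_on \<sigma> A}"

text \<open>Every firm of \<open>A\<close> is matched here, whereas matchings of the market may be
  partial. For nonnegative entries and finite sets with \<open>card A \<le> card B\<close> this is
  the coalition value; for \<open>card A > card B\<close> the maximum is over the empty set and
  carries no meaning.\<close>

definition opt_value :: "('f \<times> 'w \<Rightarrow> real) \<Rightarrow> 'f set \<Rightarrow> 'w set \<Rightarrow> real" where
  "opt_value c A B = Max ((\<lambda>\<sigma>. \<Sum>f\<in>A. c (f, \<sigma> f)) ` injections A B)"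

definition marginal :: "('f \<times> 'w \<Rightarrow> real) \<Rightarrow> 'f set \<Rightarrow> 'w set \<Rightarrow> 'f \<Rightarrow> real" where
  "marginal c A B f = opt_value c A B - opt_value c (A - {f}) B"

lemma finite_injections [simp]: "finite A \<Longrightarrow> finite B \<Longrightarrow> finite (injections A B)"
  unfolding injections_def by (simp add: finite_PiE)

lemma inj_on_upd_insert:
  assumes "inj_on \<sigma> A" "f \<notin> A" "x \<notin> \<sigma> ` A"
  shows "inj_on (\<sigma>(f := x)) (insert f A)"
  using assms by (auto simp: inj_on_def)

lemma image_upd_insert: "f \<notin> A \<Longrightarrow> (\<sigma>(f := x)) ` insert f A = insert x (\<sigma> ` A)"
  by auto

lemma opt_value_ge:
  assumes "finite A" "finite B" "inj_on \<sigma> A" "\<sigma> ` A \<subseteq> B"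
  shows "(\<Sum>f\<in>A. c (f, \<sigma> f)) \<le> opt_value c A B"
proof -
  have "restrict \<sigma> A \<in> injections A B"
    using assms by (auto simp: injections_def inj_on_restrict_eq)
  moreover have "(\<Sum>f\<in>A. c (f, \<sigma> f)) = (\<Sum>f\<in>A. c (f, restrict \<sigma> A f))"
    by simp
  ultimately show ?thesis
    unfolding opt_value_def using assms by (intro Max_ge) (auto simp del: restrict_apply)
qed

lemma opt_value_attained:
  assumes "finite A" "finite B" "card A \<le> card B"
  obtains \<sigma> where "inj_on \<sigma> A" "\<sigma> ` A \<subseteq> B" "opt_value c A B = (\<Sum>f\<in>A. c (f, \<sigma> f))"
proof -
  obtain g where "inj_on g A" "g ` A \<subseteq> B"
    using card_le_inj[OF assms] by blast
  hence "restrict g A \<in> injections A B"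
    by (auto simp: injections_def inj_on_restrict_eq)
  hence "injections A B \<noteq> {}" by blast
  hence "opt_value c A B \<in> (\<lambda>\<sigma>. \<Sum>f\<in>A. c (f, \<sigma> f)) ` injections A B"
    unfolding opt_value_def using assms by (intro Max_in) auto
  then obtain \<sigma> where "\<sigma> \<in> injections A B" "opt_value c A B = (\<Sum>f\<in>A. c (f, \<sigma> f))"
    by auto
  thus ?thesis
    by (intro that) (auto simp: injections_def)
qed

lemma opt_value_mono:
  assumes "finite A" "finite Y" "card A \<le> card B" "B \<subseteq> Y"
  shows "opt_value c A B \<le> opt_value c A Y"
proof -
  have "finite B" using assms finite_subset by blast
  with assms obtain \<sigma> where s: "inj_on \<sigma> A" "\<sigma> ` A \<subseteq> B" "opt_value c A B = (\<Sum>f\<in>A. c (f, \<sigma> f))"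
    using opt_value_attained by metis
  thus ?thesis
    using opt_value_ge[of A Y \<sigma> c] assms by auto
qed

lemma opt_value_cong:
  assumes "\<And>f w. f \<in> A \<Longrightarrow> w \<in> B \<Longrightarrow> c (f, w) = c' (f, w)"
  shows "opt_value c A B = opt_value c' A B"
  unfolding opt_value_def injections_def
  by (intro arg_cong[where f = Max] image_cong refl sum.cong) (auto intro!: assms)

lemma marginal_cong:
  assumes "\<And>f w. f \<in> A \<Longrightarrow> w \<in> B \<Longrightarrow> c (f, w) = c' (f, w)"
  shows "marginal c A B f = marginal c' A B f"
  unfolding marginal_def by (intro arg_cong2[where f = "(-)"] opt_value_cong) (auto intro: assms)

text \<open>Composition with \<open>\<pi>\<close> turns the injections into \<open>B\<close> into
  those into its image. This makes exchangeability of the columns usable for optimal values.\<close>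

lemma opt_value_reindex:
  assumes "inj \<pi>"
  shows "opt_value (\<lambda>(f, w). c (f, \<pi> w)) A B = opt_value c A (\<pi> ` B)"
proof -
  have "injections A (\<pi> ` B) = (\<lambda>\<sigma>. restrict (\<pi> \<circ> \<sigma>) A) ` injections A B"
  proof (intro equalityI subsetI)
    fix \<tau> assume t: "\<tau> \<in> injections A (\<pi> ` B)"
    define \<sigma> where "\<sigma> = restrict (inv \<pi> \<circ> \<tau>) A"
    have 1: "\<sigma> f \<in> B" "\<pi> (\<sigma> f) = \<tau> f" if f: "f \<in> A" for f
    proof -
      have "\<tau> f \<in> \<pi> ` B" using t f by (auto simp: injections_def)
      then show "\<sigma> f \<in> B" "\<pi> (\<sigma> f) = \<tau> f" using f assms by (auto simp: \<sigma>_def)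
    qed
    have "\<tau> = restrict (\<pi> \<circ> \<sigma>) A"
      using t 1(2) by (auto simp: fun_eq_iff injections_def PiE_def extensional_def)
    moreover have "\<sigma> \<in> injections A B"
    proof -
      have "inj_on \<sigma> A"
      proof (rule inj_on_imageI2)
        have "inj_on \<tau> A" using t by (simp add: injections_def)
        thus "inj_on (\<pi> \<circ> \<sigma>) A" using 1(2) by (subst inj_on_cong[of A _ \<tau>]) auto
      qed
      moreover have "\<sigma> \<in> A \<rightarrow>\<^sub>E B" using 1(1) by (auto simp: \<sigma>_def)
      ultimately show ?thesis by (simp add: injections_def)
    qed
    ultimately show "\<tau> \<in> (\<lambda>\<sigma>. restrict (\<pi> \<circ> \<sigma>) A) ` injections A B" by blast
  next
    fix \<tau> assume "\<tau> \<in> (\<lambda>\<sigma>. restrict (\<pi> \<circ> \<sigma>) A) ` injections A B"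
    then obtain \<sigma> where s: "\<tau> = restrict (\<pi> \<circ> \<sigma>) A" "inj_on \<sigma> A" "\<sigma> \<in> A \<rightarrow>\<^sub>E B"
      by (auto simp: injections_def)
    have "inj_on (\<pi> \<circ> \<sigma>) A"
      using s(2) inj_on_subset[OF assms] by (intro comp_inj_on) auto
    with s show "\<tau> \<in> injections A (\<pi> ` B)"
      by (auto simp: injections_def)
  qed
  thus ?thesis
    unfolding opt_value_def by (simp add: image_image)
qed

text \<open>
  The edges of two injections can be recombined so that \<open>x\<close> changes sides. Following the alternating
  path from \<open>x\<close> becomes an induction on \<open>A\<close>: swap at the firm holding \<open>x\<close>, then recurse
  on the worker that this firm held in the other injection.
\<close>
lemma exchange:
  assumes "finite A" "inj_on \<sigma> A" "inj_on \<tau> A" "x \<in> \<sigma> ` A" "x \<notin> \<tau> ` A"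
  obtains \<sigma>' \<tau>' y where "inj_on \<sigma>' A" "inj_on \<tau>' A" "y \<in> \<tau> ` A" "y \<notin> \<sigma> ` A"
    "\<sigma>' ` A = insert y (\<sigma> ` A - {x})" "\<tau>' ` A = insert x (\<tau> ` A - {y})"
    "\<And>f. f \<in> A \<Longrightarrow> \<sigma>' f = \<sigma> f \<and> \<tau>' f = \<tau> f \<or> \<sigma>' f = \<tau> f \<and> \<tau>' f = \<sigma> f"
proof -
  have "\<exists>\<sigma>' \<tau>' y. inj_on \<sigma>' A \<and> inj_on \<tau>' A \<and> y \<in> \<tau> ` A \<and> y \<notin> \<sigma> ` A \<and>
    \<sigma>' ` A = insert y (\<sigma> ` A - {x}) \<and> \<tau>' ` A = insert x (\<tau> ` A - {y}) \<and>
    (\<forall>f\<in>A. \<sigma>' f = \<sigma> f \<and> \<tau>' f = \<tau> f \<or> \<sigma>' f = \<tau> f \<and> \<tau>' f = \<sigma> f)"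
    using assms
  proof (induction "card A" arbitrary: A x)
    case 0 thus ?case by auto
  next
    case (Suc k)
    from Suc.prems obtain f where f: "f \<in> A" "\<sigma> f = x" by auto
    define A' where "A' = A - {f}"
    have A: "A = insert f A'" "f \<notin> A'" "finite A'" "card A' = k"
      using f Suc by (auto simp: A'_def)
    define x' where "x' = \<tau> f"
    have xx': "x \<noteq> x'" using Suc.prems f by (auto simp: x'_def)
    have s: "inj_on \<sigma> A'" "x \<notin> \<sigma> ` A'" "\<sigma> ` A = insert x (\<sigma> ` A')"
      using Suc.prems(2) f A by auto
    have t: "inj_on \<tau> A'" "x' \<notin> \<tau> ` A'" "\<tau> ` A = insert x' (\<tau> ` A')"
      using Suc.prems(3) f A by (auto simp: x'_def)
    show ?case
    proof (cases "x' \<in> \<sigma> ` A'")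
      \<comment> \<open>The alternating path ends: \<open>x'\<close> is free in
        \<open>\<sigma>\<close>, so a swap at \<open>f\<close> alone suffices and \<open>y\<close>
        is \<open>x'\<close>.\<close>
      case False
      define \<sigma>' \<tau>' where "\<sigma>' = \<sigma>(f := x')" and "\<tau>' = \<tau>(f := x)"
      have x: "x \<notin> \<tau> ` A'" using Suc.prems(5) t(3) by blast
      have "inj_on \<sigma>' A" "inj_on \<tau>' A"
        unfolding A(1) \<sigma>'_def \<tau>'_def using A(2) s(1) t(1) False x
        by (simp_all only: inj_on_upd_insert not_False_eq_True)
      moreover have "\<sigma>' ` A = insert x' (\<sigma> ` A')" "\<tau>' ` A = insert x (\<tau> ` A')"
        unfolding A(1) \<sigma>'_def \<tau>'_def using A(2) by (simp_all only: image_upd_insert not_False_eq_True)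
      hence "\<sigma>' ` A = insert x' (\<sigma> ` A - {x})" "\<tau>' ` A = insert x (\<tau> ` A - {x'})"
        using s(2,3) t(2,3) by simp_all
      moreover have "\<forall>g\<in>A. \<sigma>' g = \<sigma> g \<and> \<tau>' g = \<tau> g \<or> \<sigma>' g = \<tau> g \<and> \<tau>' g = \<sigma> g"
        using f by (auto simp: \<sigma>'_def \<tau>'_def x'_def)
      moreover have "x' \<in> \<tau> ` A" "x' \<notin> \<sigma> ` A" using False t s xx' by auto
      ultimately show ?thesis
        by (intro exI[of _ \<sigma>'] exI[of _ \<tau>'] exI[of _ x'] conjI)
    next
      \<comment> \<open>Without \<open>f\<close>, the worker \<open>x'\<close> is used by
        \<open>\<sigma>\<close> but not by \<open>\<tau>\<close>, so it takes over the role of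
        \<open>x\<close>. The recursion removes it from the range of \<open>\<sigma>1\<close>, which
        leaves it free for \<open>f\<close>.\<close>
      case True
      from Suc.hyps(1)[OF A(4)[symmetric] A(3) s(1) t(1) True t(2)]
      obtain \<sigma>1 \<tau>1 y where h: "inj_on \<sigma>1 A'" "inj_on \<tau>1 A'" "y \<in> \<tau> ` A'" "y \<notin> \<sigma> ` A'"
        "\<sigma>1 ` A' = insert y (\<sigma> ` A' - {x'})" "\<tau>1 ` A' = insert x' (\<tau> ` A' - {y})"
        "\<forall>g\<in>A'. \<sigma>1 g = \<sigma> g \<and> \<tau>1 g = \<tau> g \<or> \<sigma>1 g = \<tau> g \<and> \<tau>1 g = \<sigma> g"
        by (elim exE conjE) (rule that)
      define \<sigma>' \<tau>' where "\<sigma>' = \<sigma>1(f := x')" and "\<tau>' = \<tau>1(f := x)"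
      have y: "y \<noteq> x" "y \<noteq> x'" using h(3) t Suc.prems(5) A by auto
      have n: "x' \<notin> \<sigma>1 ` A'" "x \<notin> \<tau>1 ` A'"
        using h y xx' t Suc.prems(5) by auto
      have "inj_on \<sigma>' A" "inj_on \<tau>' A"
        unfolding A(1) \<sigma>'_def \<tau>'_def using A(2) h(1,2) n
        by (simp_all only: inj_on_upd_insert not_False_eq_True)
      moreover have "\<sigma>' ` A = insert y (\<sigma> ` A - {x})"
      proof -
        have "\<sigma>' ` A = insert x' (\<sigma>1 ` A')"
          unfolding A(1) \<sigma>'_def using A(2) by (rule image_upd_insert)
        thus ?thesis using h(5) True s(2,3) xx' by auto
      qed
      moreover have "\<tau>' ` A = insert x (\<tau> ` A - {y})"
      proof -
        have "\<tau>' ` A = insert x (\<tau>1 ` A')"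
          unfolding A(1) \<tau>'_def using A(2) by (rule image_upd_insert)
        thus ?thesis using h(6) t(2,3) y by auto
      qed
      moreover have "\<forall>g\<in>A. \<sigma>' g = \<sigma> g \<and> \<tau>' g = \<tau> g \<or> \<sigma>' g = \<tau> g \<and> \<tau>' g = \<sigma> g"
        using h(7) f unfolding A(1) by (auto simp: \<sigma>'_def \<tau>'_def x'_def)
      moreover have "y \<in> \<tau> ` A" "y \<notin> \<sigma> ` A" using h s t y by auto
      ultimately show ?thesis
        by (intro exI[of _ \<sigma>'] exI[of _ \<tau>'] exI[of _ y] conjI)
    qed
  qed
  thus ?thesis by (elim exE conjE) (rule that, auto)
qed

lemma sum_swap_eq:
  fixes c :: "'f \<times> 'w \<Rightarrow> real"
  assumes "\<And>f. f \<in> A \<Longrightarrow> \<sigma>' f = \<sigma> f \<and> \<tau>' f = \<tau> f \<or> \<sigma>' f = \<tau> f \<and> \<tau>' f = \<sigma> f"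
  shows "(\<Sum>f\<in>A. c (f, \<sigma>' f)) + (\<Sum>f\<in>A. c (f, \<tau>' f))
       = (\<Sum>f\<in>A. c (f, \<sigma> f)) + (\<Sum>f\<in>A. c (f, \<tau> f))"
  unfolding sum.distrib[symmetric] using assms by (intro sum.cong) fastforce+

section \<open>Marginal values and additional workers\<close>

lemma add_edge_le_opt_value:
  assumes "finite A" "finite B" "f \<in> A" "card A \<le> Suc (card B)" "x \<notin> B"
  shows "c (f, x) + opt_value c (A - {f}) B \<le> opt_value c A (insert x B)"
proof -
  have "card (A - {f}) \<le> card B" using assms by simp
  then obtain \<sigma> where s: "inj_on \<sigma> (A - {f})" "\<sigma> ` (A - {f}) \<subseteq> B"
    "opt_value c (A - {f}) B = (\<Sum>g\<in>A - {f}. c (g, \<sigma> g))"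
    using opt_value_attained[of "A - {f}" B] assms by auto
  define \<tau> where "\<tau> = \<sigma>(f := x)"
  have "inj_on \<tau> (insert f (A - {f}))"
    unfolding \<tau>_def using s assms(5) by (intro inj_on_upd_insert) auto
  hence "inj_on \<tau> A" using assms(3) by (simp add: insert_absorb)
  moreover have "\<tau> ` A \<subseteq> insert x B" using s by (auto simp: \<tau>_def)
  ultimately have "(\<Sum>g\<in>A. c (g, \<tau> g)) \<le> opt_value c A (insert x B)"
    using assms by (intro opt_value_ge) auto
  moreover have "(\<Sum>g\<in>A. c (g, \<tau> g)) = c (f, x) + (\<Sum>g\<in>A - {f}. c (g, \<tau> g))"
    using assms by (simp add: sum.remove[of A f] \<tau>_def)
  moreover have "(\<Sum>g\<in>A - {f}. c (g, \<tau> g)) = (\<Sum>g\<in>A - {f}. c (g, \<sigma> g))"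
    by (intro sum.cong) (auto simp: \<tau>_def)
  ultimately show ?thesis using s by simp
qed

text \<open>Otherwise giving \<open>x\<close> to \<open>f\<close> and matching the other firms
  optimally within \<open>B\<close> would beat the optimum over \<open>Y\<close>. This is the weak
  half of the criterion for new columns; \<open>new_workers_unused\<close> is the strict
  half.\<close>

lemma le_marginal_if_new_workers_useless:
  assumes "finite A" "finite Y" "B \<subseteq> Y" "card A \<le> card B"
    and "opt_value c A Y = opt_value c A B" "f \<in> A" "x \<in> Y - B"
  shows "c (f, x) \<le> marginal c A B f"
proof -
  have B: "finite B" using assms finite_subset by blast
  have "c (f, x) + opt_value c (A - {f}) B \<le> opt_value c A (insert x B)"
    using assms B by (intro add_edge_le_opt_value) auto
  also have "\<dots> \<le> opt_value c A Y"
    using assms B by (intro opt_value_mono) (auto simp: card_insert_if)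
  finally show ?thesis using assms by (simp add: marginal_def)
qed

text \<open>An injection that uses a new worker \<open>x\<close> is exchanged at \<open>x\<close>
  with an optimal \<open>\<tau>\<close> into \<open>B\<close>. One of the results uses one new
  worker fewer. The other uses only \<open>x\<close>, held by some \<open>f\<close>, so its value is
  at most \<open>c (f, x)\<close> plus the optimum without \<open>f\<close>, which is less than the
  optimum over \<open>B\<close>. The sum of the two values is preserved, so by induction on the
  number of new workers every injection that uses one is strictly worse than
  \<open>\<tau>\<close>.\<close>

lemma new_workers_unused:
  assumes fin: "finite A" "finite Y" and B: "B \<subseteq> Y" "card A \<le> card B"
    and less: "\<And>f x. f \<in> A \<Longrightarrow> x \<in> Y - B \<Longrightarrow> c (f, x) < marginal c A B f"
    and s: "inj_on \<sigma> A" "\<sigma> ` A \<subseteq> Y" "opt_value c A Y = (\<Sum>f\<in>A. c (f, \<sigma> f))"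
  shows "\<sigma> ` A \<subseteq> B"
proof -
  have finB: "finite B" using fin B finite_subset by blast
  obtain \<tau> where t: "inj_on \<tau> A" "\<tau> ` A \<subseteq> B" "opt_value c A B = (\<Sum>f\<in>A. c (f, \<tau> f))"
    using opt_value_attained[OF fin(1) finB B(2)] by blast
  have key: "(\<Sum>f\<in>A. c (f, \<sigma> f)) \<le> opt_value c A B \<and>
       (\<not> \<sigma> ` A \<subseteq> B \<longrightarrow> (\<Sum>f\<in>A. c (f, \<sigma> f)) < opt_value c A B)"
    if "inj_on \<sigma> A" "\<sigma> ` A \<subseteq> Y" for \<sigma>
    using that
  proof (induction "card (\<sigma> ` A - B)" arbitrary: \<sigma>)
    case 0
    hence "\<sigma> ` A \<subseteq> B" using fin by auto
    thus ?case using 0 fin finB by (simp add: opt_value_ge)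
  next
    case (Suc k)
    then obtain x where x: "x \<in> \<sigma> ` A" "x \<notin> B"
      by (metis Diff_iff card.empty equals0I nat.distinct(1))
    hence "x \<notin> \<tau> ` A" using t by auto
    then obtain \<sigma>' \<tau>' y where h: "inj_on \<sigma>' A" "inj_on \<tau>' A" "y \<in> \<tau> ` A" "y \<notin> \<sigma> ` A"
      "\<sigma>' ` A = insert y (\<sigma> ` A - {x})" "\<tau>' ` A = insert x (\<tau> ` A - {y})"
      "\<And>f. f \<in> A \<Longrightarrow> \<sigma>' f = \<sigma> f \<and> \<tau>' f = \<tau> f \<or> \<sigma>' f = \<tau> f \<and> \<tau>' f = \<sigma> f"
      using exchange[OF fin(1) Suc.prems(1) t(1) x(1)] by metis
    have y: "y \<in> B" using h t by auto
    have "\<sigma>' ` A - B = (\<sigma> ` A - B) - {x}" using h y by auto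
    hence "card (\<sigma>' ` A - B) = k" using Suc.hyps(2) x fin by simp
    moreover have "\<sigma>' ` A \<subseteq> Y" using h y Suc.prems B by auto
    ultimately have 1: "(\<Sum>f\<in>A. c (f, \<sigma>' f)) \<le> opt_value c A B"
      using Suc.hyps(1)[of \<sigma>'] h by simp
    have "x \<in> \<tau>' ` A" unfolding h(6) by simp
    then obtain f where f: "f \<in> A" "\<tau>' f = x" by auto
    have "\<tau>' ` (A - {f}) \<subseteq> B"
    proof
      fix w assume "w \<in> \<tau>' ` (A - {f})"
      then obtain g where g: "g \<in> A" "g \<noteq> f" "w = \<tau>' g" by auto
      hence "w \<noteq> x" using h(2) f by (auto dest: inj_onD)
      moreover have "w \<in> insert x (\<tau> ` A - {y})" using g h(6) by auto
      ultimately show "w \<in> B" using t by auto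
    qed
    hence "(\<Sum>g\<in>A - {f}. c (g, \<tau>' g)) \<le> opt_value c (A - {f}) B"
      using h(2) fin finB by (intro opt_value_ge) (auto intro: inj_on_subset)
    moreover have "(\<Sum>g\<in>A. c (g, \<tau>' g)) = c (f, x) + (\<Sum>g\<in>A - {f}. c (g, \<tau>' g))"
      using f fin by (simp add: sum.remove[of A f])
    moreover have "c (f, x) < marginal c A B f"
      using x f Suc.prems by (intro less) auto
    ultimately have 2: "(\<Sum>g\<in>A. c (g, \<tau>' g)) < opt_value c A B"
      by (simp add: marginal_def)
    have "(\<Sum>f\<in>A. c (f, \<sigma>' f)) + (\<Sum>f\<in>A. c (f, \<tau>' f))
        = (\<Sum>f\<in>A. c (f, \<sigma> f)) + (\<Sum>f\<in>A. c (f, \<tau> f))"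
      by (rule sum_swap_eq) (use h(7) in auto)
    thus ?case using 1 2 t by auto
  qed
  have "opt_value c A B \<le> opt_value c A Y"
    using fin B by (intro opt_value_mono)
  thus ?thesis using key[OF s(1,2)] s(3) by auto
qed

text \<open>An optimal matching without \<open>f\<close> leaves some worker of \<open>B\<close>
  free, and \<open>f\<close> can take that worker. Hence marginals inherit positivity from the
  entries.\<close>

lemma opt_value_remove_le:
  assumes "finite A" "finite B" "f \<in> A" "card A \<le> card B"
  obtains w where "w \<in> B" "c (f, w) \<le> marginal c A B f"
proof -
  have lt: "card (A - {f}) < card B" using assms by (metis card_Diff1_less less_le_trans)
  then obtain \<sigma> where s: "inj_on \<sigma> (A - {f})" "\<sigma> ` (A - {f}) \<subseteq> B"
    "opt_value c (A - {f}) B = (\<Sum>g\<in>A - {f}. c (g, \<sigma> g))"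
    using opt_value_attained[of "A - {f}" B] assms by auto
  have "card (\<sigma> ` (A - {f})) < card B"
    using lt s(1) by (simp add: card_image)
  then obtain w where w: "w \<in> B" "w \<notin> \<sigma> ` (A - {f})"
    using s(2) by (metis nat_neq_iff subsetI subset_antisym)
  have fB: "finite (B - {w})" using assms by simp
  have "opt_value c (A - {f}) B \<le> opt_value c (A - {f}) (B - {w})"
    unfolding s(3) using s w assms by (intro opt_value_ge) auto
  moreover have "c (f, w) + opt_value c (A - {f}) (B - {w}) \<le> opt_value c A (insert w (B - {w}))"
    using assms fB w lt by (intro add_edge_le_opt_value) (auto simp: Suc_le_eq)
  ultimately have "c (f, w) \<le> marginal c A B f"
    using w by (simp add: marginal_def insert_absorb)
  with w that show thesis by blast
qed

lemma marginal_pos: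
  assumes "finite A" "finite B" "f \<in> A" "card A \<le> card B" "\<And>w. w \<in> B \<Longrightarrow> 0 < c (f, w)"
  shows "0 < marginal c A B f"
  using opt_value_remove_le[OF assms(1-4), of c] assms(5) by (metis less_le_trans)

text \<open>Dropping \<open>f\<close> from an optimal matching costs exactly the entry of
  \<open>f\<close> with its partner.\<close>

lemma marginal_le_entry:
  assumes "finite A" "finite B" "f \<in> A" "card A \<le> card B"
  obtains w where "w \<in> B" "marginal c A B f \<le> c (f, w)"
proof -
  obtain \<sigma> where s: "inj_on \<sigma> A" "\<sigma> ` A \<subseteq> B" "opt_value c A B = (\<Sum>g\<in>A. c (g, \<sigma> g))"
    using opt_value_attained[OF assms(1,2,4)] by blast
  have "(\<Sum>g\<in>A - {f}. c (g, \<sigma> g)) \<le> opt_value c (A - {f}) B"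
    using s assms by (intro opt_value_ge) (auto intro: inj_on_subset)
  hence "marginal c A B f \<le> c (f, \<sigma> f)"
    using s assms by (simp add: marginal_def sum.remove[of A f])
  thus thesis using s assms by (intro that[of "\<sigma> f"]) auto
qed

lemma opt_value_empty [simp]: "opt_value c {} B = 0"
  by (simp add: opt_value_def injections_def)

section \<open>Firm-optimal core allocations\<close>

text \<open>For \<open>w = \<sigma> f\<close> the inequality says that
  \<open>c (f, w) - marginal c F W f\<close>, the salary that its partner leaves to
  \<open>w\<close>, is at least what any firm \<open>g\<close> could offer while keeping its own
  marginal. To prove it, \<open>\<sigma>\<close> without \<open>f\<close> is exchanged with an
  optimal matching without \<open>g\<close>; the edge \<open>(g, w)\<close> is then added to the
  result that has room for it.\<close>

lemma marginal_edge_le: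
  fixes c :: "'f \<times> 'w \<Rightarrow> real"
  assumes fin: "finite F" "finite W" and card: "card F = card W"
    and s: "inj_on \<sigma> F" "\<sigma> ` F = W" "opt_value c F W = (\<Sum>h\<in>F. c (h, \<sigma> h))"
    and fg: "f \<in> F" "g \<in> F"
  shows "c (g, \<sigma> f) + opt_value c (F - {g}) W \<le> c (f, \<sigma> f) + opt_value c (F - {f}) W"
proof (cases "f = g")
  case False
  define w where "w = \<sigma> f"
  have w: "w \<in> W" using s fg by (auto simp: w_def)
  obtain \<rho> where r: "inj_on \<rho> (F - {g})" "\<rho> ` (F - {g}) \<subseteq> W"
    "opt_value c (F - {g}) W = (\<Sum>h\<in>F - {g}. c (h, \<rho> h))"
    using opt_value_attained[of "F - {g}" W] fin card by (metis card_Diff1_le finite_Diff)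
  \<comment> \<open>Two dummy workers of value 0 turn \<open>\<sigma>\<close> without \<open>f\<close> and \<open>\<rho>\<close> into injections on all of \<open>F\<close>.\<close>
  define c1 :: "'f \<times> ('w + bool) \<Rightarrow> real"
    where "c1 = (\<lambda>(h, x). case x of Inl w \<Rightarrow> c (h, w) | Inr _ \<Rightarrow> 0)"
  have c1 [simp]: "c1 (h, Inl a) = c (h, a)" "c1 (h, Inr b) = 0" for h a b
    by (auto simp: c1_def)
  have le: "(\<Sum>h\<in>D. c1 (h, \<tau> h)) \<le> opt_value c D B"
    if "inj_on \<tau> D" "\<tau> ` D \<subseteq> Inl ` B" "D \<subseteq> F" "B \<subseteq> W" for \<tau> D B
  proof -
    have p: "projl (\<tau> h) \<in> B" "\<tau> h = Inl (projl (\<tau> h))" if "h \<in> D" for h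
      using \<open>\<tau> ` D \<subseteq> Inl ` B\<close> that by auto
    have "inj_on (projl \<circ> \<tau>) D"
    proof (rule inj_on_imageI2)
      show "inj_on ((Inl :: 'w \<Rightarrow> 'w + bool) \<circ> (projl \<circ> \<tau>)) D"
        using \<open>inj_on \<tau> D\<close> by (rule inj_on_cong[THEN iffD1, rotated]) (simp add: p(2)[symmetric])
    qed
    moreover have "finite D" "finite B" using that fin finite_subset by blast+
    ultimately have "(\<Sum>h\<in>D. c (h, (projl \<circ> \<tau>) h)) \<le> opt_value c D B"
      using p(1) by (intro opt_value_ge) (auto simp: comp_def)
    moreover have "(\<Sum>h\<in>D. c (h, (projl \<circ> \<tau>) h)) = (\<Sum>h\<in>D. c1 (h, \<tau> h))"
    proof (intro sum.cong refl)
      fix h assume "h \<in> D"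
      show "c (h, (projl \<circ> \<tau>) h) = c1 (h, \<tau> h)"
        using p(2)[OF \<open>h \<in> D\<close>] by (metis c1(1) comp_apply)
    qed
    ultimately show ?thesis by simp
  qed
  define \<sigma>1 \<rho>1 where "\<sigma>1 = (Inl \<circ> \<sigma>)(f := Inr True)" and "\<rho>1 = (Inl \<circ> \<rho>)(g := Inr False)"
  have s_F: "\<sigma> ` (F - {f}) = W - {w}"
    using s fg by (simp add: inj_on_image_set_diff[of \<sigma> F] w_def)
  have F: "F = insert f (F - {f})" "F = insert g (F - {g})" using fg by auto
  have im1: "\<sigma>1 ` F = insert (Inr True) (Inl ` (W - {w}))"
  proof -
    have "\<sigma>1 ` F = insert (Inr True) ((Inl \<circ> \<sigma>) ` (F - {f}))"
      unfolding \<sigma>1_def by (subst F(1), rule image_upd_insert) simp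
    thus ?thesis by (simp add: image_image s_F[symmetric])
  qed
  have im2: "\<rho>1 ` F = insert (Inr False) (Inl ` (\<rho> ` (F - {g})))"
  proof -
    have "\<rho>1 ` F = insert (Inr False) ((Inl \<circ> \<rho>) ` (F - {g}))"
      unfolding \<rho>1_def by (subst F(2), rule image_upd_insert) simp
    thus ?thesis by (simp add: image_image)
  qed
  have inj1: "inj_on \<sigma>1 F"
    unfolding \<sigma>1_def by (subst F(1), rule inj_on_upd_insert)
      (use s in \<open>auto intro!: comp_inj_on intro: inj_on_subset\<close>)
  have inj2: "inj_on \<rho>1 F"
    unfolding \<rho>1_def by (subst F(2), rule inj_on_upd_insert)
      (use r in \<open>auto intro!: comp_inj_on intro: inj_on_subset\<close>)
  have "Inr True \<in> \<sigma>1 ` F" "Inr True \<notin> \<rho>1 ` F"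
    unfolding im1 im2 by auto
  then obtain \<sigma>' \<rho>' y where h: "inj_on \<sigma>' F" "inj_on \<rho>' F" "y \<in> \<rho>1 ` F" "y \<notin> \<sigma>1 ` F"
    "\<sigma>' ` F = insert y (\<sigma>1 ` F - {Inr True})" "\<rho>' ` F = insert (Inr True) (\<rho>1 ` F - {y})"
    "\<And>h. h \<in> F \<Longrightarrow> \<sigma>' h = \<sigma>1 h \<and> \<rho>' h = \<rho>1 h \<or> \<sigma>' h = \<rho>1 h \<and> \<rho>' h = \<sigma>1 h"
    by (rule exchange[OF fin(1) inj1 inj2]) (rule that)
  have sums: "(\<Sum>h\<in>F. c1 (h, \<sigma>' h)) + (\<Sum>h\<in>F. c1 (h, \<rho>' h))
     = (opt_value c F W - c (f, w)) + opt_value c (F - {g}) W"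
  proof -
    have "(\<Sum>h\<in>F. c1 (h, \<sigma>1 h)) = (\<Sum>h\<in>F - {f}. c (h, \<sigma> h))"
      using fin fg by (subst sum.remove[of F f]) (auto simp: \<sigma>1_def intro!: sum.cong)
    moreover have "(\<Sum>h\<in>F. c1 (h, \<rho>1 h)) = (\<Sum>h\<in>F - {g}. c (h, \<rho> h))"
      using fin fg by (subst sum.remove[of F g]) (auto simp: \<rho>1_def intro!: sum.cong)
    moreover have "opt_value c F W = c (f, w) + (\<Sum>h\<in>F - {f}. c (h, \<sigma> h))"
      using fin fg s by (simp add: sum.remove[of F f] w_def)
    ultimately show ?thesis
      using sum_swap_eq[of F \<sigma>' \<sigma>1 \<rho>' \<rho>1 c1] h(7) r(3) by simp
  qed
  have only: "h = f" if "h \<in> F" "\<rho>' h = Inr True" for h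
    using h(7)[OF that(1)] that(2) by (auto simp: \<sigma>1_def \<rho>1_def split: if_splits)
  have "Inr True \<in> \<rho>' ` F" using h(6) by auto
  hence rf: "\<rho>' f = Inr True" using only by force
  have rW: "\<rho>' ` (F - {f}) \<subseteq> \<rho>1 ` F - {y}"
    using h(6) only by auto
  have card_le: "card (F - {h}) \<le> card W" for h using fin card by (metis card_Diff1_le)
  \<comment> \<open>Among the workers of \<open>W\<close>, \<open>\<sigma>1\<close> misses only
    \<open>w\<close>, so the exchange path can end nowhere else.\<close>
  have "y = Inr False \<or> y = Inl w"
    using h(3,4) r(2) unfolding im1 im2 by auto
  thus ?thesis
  proof
    \<comment> \<open>Now \<open>\<sigma>'\<close> leaves out \<open>g\<close> and \<open>w\<close>,
      so the edge \<open>(g, w)\<close> completes it to a matching of all firms, while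
      \<open>\<rho>'\<close> is a matching without \<open>f\<close>.\<close>
    assume y: "y = Inr False"
    have only': "k = g" if "k \<in> F" "\<sigma>' k = Inr False" for k
      using h(7)[OF that(1)] that(2) by (auto simp: \<sigma>1_def \<rho>1_def split: if_splits)
    have "Inr False \<in> \<sigma>' ` F" using h(5) y by auto
    hence sg: "\<sigma>' g = Inr False" using only' by force
    have "\<sigma>' ` (F - {g}) \<subseteq> Inl ` (W - {w})"
      using h(5) only' y unfolding im1 by auto
    hence "(\<Sum>h\<in>F - {g}. c1 (h, \<sigma>' h)) \<le> opt_value c (F - {g}) (W - {w})"
      using h(1) by (intro le) (auto intro: inj_on_subset)
    moreover have "c (g, w) + opt_value c (F - {g}) (W - {w}) \<le> opt_value c F (insert w (W - {w}))"
      using fin fg card w by (intro add_edge_le_opt_value) auto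
    moreover have "\<rho>' ` (F - {f}) \<subseteq> Inl ` W"
      using rW r(2) y unfolding im2 by auto
    hence "(\<Sum>h\<in>F - {f}. c1 (h, \<rho>' h)) \<le> opt_value c (F - {f}) W"
      using h(2) by (intro le) (auto intro: inj_on_subset)
    ultimately show ?thesis
      using sums fin fg rf sg w
      by (simp add: sum.remove[of F f "\<lambda>h. c1 (h, \<rho>' h)"] sum.remove[of F g "\<lambda>h. c1 (h, \<sigma>' h)"]
          insert_absorb flip: w_def)
  next
    \<comment> \<open>Now \<open>\<sigma>'\<close> matches all firms, while \<open>\<rho>'\<close>
      holds both dummies and misses \<open>w\<close>, so the edge \<open>(g, w)\<close> extends it
      to a matching without \<open>f\<close>.\<close>
    assume y: "y = Inl w"
    have only': "k = g" if "k \<in> F" "\<rho>' k = Inr False" for k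
      using h(7)[OF that(1)] that(2) by (auto simp: \<sigma>1_def \<rho>1_def split: if_splits)
    have "Inr False \<in> \<rho>' ` F" using h(6) y unfolding im2 by auto
    hence rg: "\<rho>' g = Inr False" using only' by force
    have "\<sigma>' ` F \<subseteq> Inl ` W"
      using h(5) y w unfolding im1 by auto
    hence "(\<Sum>h\<in>F. c1 (h, \<sigma>' h)) \<le> opt_value c F W"
      using h(1) by (intro le) auto
    moreover have "\<rho>' ` (F - {f} - {g}) \<subseteq> Inl ` (W - {w})"
    proof
      fix z assume z: "z \<in> \<rho>' ` (F - {f} - {g})"
      hence "z \<in> \<rho>1 ` F - {y}" using rW by auto
      moreover have "z \<noteq> Inr False" using z only' by auto
      ultimately show "z \<in> Inl ` (W - {w})" using r(2) y unfolding im2 by auto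
    qed
    hence "(\<Sum>h\<in>F - {f} - {g}. c1 (h, \<rho>' h)) \<le> opt_value c (F - {f} - {g}) (W - {w})"
      using h(2) by (intro le) (auto intro: inj_on_subset)
    moreover have "c (g, w) + opt_value c (F - {f} - {g}) (W - {w}) \<le> opt_value c (F - {f}) (insert w (W - {w}))"
      using fin fg card w False by (intro add_edge_le_opt_value) auto
    moreover have "(\<Sum>h\<in>F. c1 (h, \<rho>' h)) = (\<Sum>h\<in>F - {f} - {g}. c1 (h, \<rho>' h))"
      using fin fg rf rg False
      by (simp add: sum.remove[of F f "\<lambda>h. c1 (h, \<rho>' h)"]
            sum.remove[of "F - {f}" g "\<lambda>h. c1 (h, \<rho>' h)"])
    ultimately show ?thesis
      using sums w by (simp add: insert_absorb flip: w_def)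
  qed
qed simp

lemma marginal_dual:
  assumes fin: "finite F" "finite W" and card: "card F = card W"
    and nonneg: "\<And>f w. f \<in> F \<Longrightarrow> w \<in> W \<Longrightarrow> 0 \<le> c (f, w)"
  obtains \<sigma> v where "inj_on \<sigma> F" "\<sigma> ` F = W" "opt_value c F W = (\<Sum>f\<in>F. c (f, \<sigma> f))"
    "\<And>w. w \<in> W \<Longrightarrow> 0 \<le> v w"
    "\<And>f w. f \<in> F \<Longrightarrow> w \<in> W \<Longrightarrow> c (f, w) \<le> marginal c F W f + v w"
    "(\<Sum>f\<in>F. marginal c F W f) + (\<Sum>w\<in>W. v w) = opt_value c F W"
proof -
  obtain \<sigma> where s: "inj_on \<sigma> F" "\<sigma> ` F \<subseteq> W" "opt_value c F W = (\<Sum>f\<in>F. c (f, \<sigma> f))"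
    using opt_value_attained[OF fin] card by (metis order_refl)
  have sW: "\<sigma> ` F = W"
    using s fin card by (metis card_image card_subset_eq)
  define v where "v w = (let f = inv_into F \<sigma> w in c (f, w) - marginal c F W f)" for w
  have v: "v (\<sigma> f) = c (f, \<sigma> f) - marginal c F W f" if "f \<in> F" for f
    using that s by (simp add: v_def Let_def)
  have "0 \<le> v w \<and> (\<forall>g\<in>F. c (g, w) \<le> marginal c F W g + v w)" if "w \<in> W" for w
  proof -
    from that sW obtain f where f: "f \<in> F" "w = \<sigma> f" by auto
    have "(\<Sum>g\<in>F - {f}. c (g, \<sigma> g)) \<le> opt_value c (F - {f}) W"
      using s fin by (intro opt_value_ge) (auto intro: inj_on_subset)
    hence "opt_value c F W \<le> c (f, \<sigma> f) + opt_value c (F - {f}) W"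
      using s fin f by (simp add: sum.remove[of F f])
    hence "0 \<le> v w" using v[OF f(1)] f by (simp add: marginal_def)
    moreover have "c (g, w) \<le> marginal c F W g + v w" if "g \<in> F" for g
      using marginal_edge_le[OF fin card s(1) sW s(3) f(1) that] v[OF f(1)] f
      by (simp add: marginal_def)
    ultimately show ?thesis by blast
  qed
  moreover have "(\<Sum>w\<in>W. v w) = (\<Sum>f\<in>F. v (\<sigma> f))"
    using s(1) unfolding sW[symmetric] by (simp add: sum.reindex)
  hence "(\<Sum>f\<in>F. marginal c F W f) + (\<Sum>w\<in>W. v w) = opt_value c F W"
    using v s by (simp add: sum_subtractf)
  ultimately show ?thesis using that[of \<sigma> v] s sW by blast
qed

section \<open>Coalition values and core payoffs\<close>

lemma finite_matchings: "finite A \<Longrightarrow> finite B \<Longrightarrow> finite {\<mu>. is_matching A B \<mu>}"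
  by (rule finite_subset[of _ "Pow (A \<times> B)"]) (auto simp: is_matching_def)

lemma opt_value_le_coalition_value:
  assumes "finite A" "finite B" "card A \<le> card B"
  shows "opt_value (\<lambda>(f, w). \<alpha> f w) A B \<le> coalition_value \<alpha> A B"
proof -
  obtain \<sigma> where s: "inj_on \<sigma> A" "\<sigma> ` A \<subseteq> B"
    "opt_value (\<lambda>(f, w). \<alpha> f w) A B = (\<Sum>f\<in>A. (\<lambda>(f, w). \<alpha> f w) (f, \<sigma> f))"
    using opt_value_attained[OF assms] by blast
  let ?\<mu> = "(\<lambda>f. (f, \<sigma> f)) ` A"
  have "is_matching A B ?\<mu>"
    using s by (auto simp: is_matching_def inj_on_def)
  hence "matching_value \<alpha> ?\<mu> \<le> coalition_value \<alpha> A B"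
    unfolding coalition_value_def using finite_matchings[OF assms(1,2)] by (intro Max_ge) auto
  moreover have "matching_value \<alpha> ?\<mu> = (\<Sum>f\<in>A. \<alpha> f (\<sigma> f))"
    unfolding matching_value_def by (subst sum.reindex) (auto simp: inj_on_def)
  ultimately show ?thesis using s by simp
qed

text \<open>Weak duality; nonnegative payoffs account for the unmatched agents.\<close>

lemma matching_value_le_dual:
  assumes "finite A" "finite B" "is_matching A B \<mu>"
    and "\<And>f. f \<in> A \<Longrightarrow> 0 \<le> u f" "\<And>w. w \<in> B \<Longrightarrow> 0 \<le> v w"
    and "\<And>f w. f \<in> A \<Longrightarrow> w \<in> B \<Longrightarrow> \<alpha> f w \<le> u f + v w"
  shows "matching_value \<alpha> \<mu> \<le> (\<Sum>f\<in>A. u f) + (\<Sum>w\<in>B. v w)"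
proof -
  have m: "\<mu> \<subseteq> A \<times> B" "inj_on fst \<mu>" "inj_on snd \<mu>"
    using assms(3) by (auto simp: is_matching_def)
  have "matching_value \<alpha> \<mu> \<le> (\<Sum>p\<in>\<mu>. u (fst p) + v (snd p))"
    unfolding matching_value_def using m assms(6) by (intro sum_mono) auto
  also have "\<dots> = (\<Sum>f\<in>fst ` \<mu>. u f) + (\<Sum>w\<in>snd ` \<mu>. v w)"
    using m by (simp add: sum.distrib sum.reindex)
  also have "\<dots> \<le> (\<Sum>f\<in>A. u f) + (\<Sum>w\<in>B. v w)"
    using m assms by (intro add_mono sum_mono2) auto
  finally show ?thesis .
qed

text \<open>The coalition of all agents except \<open>f\<close> caps the profit of \<open>f\<close>
  at its marginal value in any core allocation. Conversely, the dual solution of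
  \<open>marginal_dual\<close> is a core allocation in which all firms earn their marginals at once,
  so the firm optimum pays at least that.\<close>

lemma firm_optimal_salaries:
  assumes fin: "finite F" "finite W" and card: "card F = card W"
    and nonneg: "\<And>f w. f \<in> F \<Longrightarrow> w \<in> W \<Longrightarrow> 0 \<le> \<alpha> f w"
    and opt: "firm_optimal_core_allocation F W \<alpha> (\<mu>, u, v)"
  defines "c \<equiv> \<lambda>(f, w). \<alpha> f w"
  shows "(\<Sum>w\<in>W. v w) = opt_value c F W - (\<Sum>f\<in>F. marginal c F W f)"
proof -
  have c: "c (f, w) = \<alpha> f w" for f w by (simp add: c_def)
  have nn: "0 \<le> c (f, w)" if "f \<in> F" "w \<in> W" for f w
    using nonneg[OF that] by (simp add: c)
  obtain \<sigma> v' where s: "inj_on \<sigma> F" "\<sigma> ` F = W" "opt_value c F W = (\<Sum>f\<in>F. c (f, \<sigma> f))"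
    and d: "\<And>w. w \<in> W \<Longrightarrow> 0 \<le> v' w"
    "\<And>f w. f \<in> F \<Longrightarrow> w \<in> W \<Longrightarrow> c (f, w) \<le> marginal c F W f + v' w"
    "(\<Sum>f\<in>F. marginal c F W f) + (\<Sum>w\<in>W. v' w) = opt_value c F W"
    by (rule marginal_dual[where c = c, OF fin card]) (rule nn, assumption+, rule that)
  let ?u = "marginal c F W"
  have d2: "\<alpha> f w \<le> ?u f + v' w" if "f \<in> F" "w \<in> W" for f w
    using d(2)[OF that] by (simp add: c)
  have u_nonneg: "0 \<le> ?u f" if f: "f \<in> F" for f
    using opt_value_remove_le[OF fin f, of c] nonneg[OF f] card c by (metis order.trans order_refl)
  have le_dual: "coalition_value \<alpha> A B \<le> (\<Sum>f\<in>A. ?u f) + (\<Sum>w\<in>B. v' w)"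
    if AB: "A \<subseteq> F" "B \<subseteq> W" for A B
    unfolding coalition_value_def
  proof (rule Max.boundedI)
    have fAB: "finite A" "finite B" using AB fin finite_subset by blast+
    show "finite (matching_value \<alpha> ` {\<mu>. is_matching A B \<mu>})"
      using finite_matchings[OF fAB] by auto
    have "is_matching A B {}" by (simp add: is_matching_def)
    thus "matching_value \<alpha> ` {\<mu>. is_matching A B \<mu>} \<noteq> {}" by blast
    fix a assume "a \<in> matching_value \<alpha> ` {\<mu>. is_matching A B \<mu>}"
    then obtain \<mu>' where m: "is_matching A B \<mu>'" "a = matching_value \<alpha> \<mu>'" by auto
    show "a \<le> (\<Sum>f\<in>A. ?u f) + (\<Sum>w\<in>B. v' w)"
      unfolding m(2) using subsetD[OF AB(1)] subsetD[OF AB(2)] d(1) d2 u_nonneg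
      by (intro matching_value_le_dual[OF fAB m(1)]) simp_all
  qed
  have core': "core_allocation F W \<alpha> ((\<lambda>f. (f, \<sigma> f)) ` F, ?u, v')"
  proof -
    have "is_matching F W ((\<lambda>f. (f, \<sigma> f)) ` F)"
      using s by (auto simp: is_matching_def inj_on_def)
    moreover have "matching_value \<alpha> ((\<lambda>f. (f, \<sigma> f)) ` F) = opt_value c F W"
      unfolding matching_value_def s(3) by (subst sum.reindex) (auto simp: inj_on_def c)
    ultimately show ?thesis
      using d(3) le_dual by (simp add: core_allocation_def feasible_allocation_def)
  qed
  have core: "core_allocation F W \<alpha> (\<mu>, u, v)"
    using opt by (simp add: firm_optimal_core_allocation_def)
  hence m: "is_matching F W \<mu>" "(\<Sum>f\<in>F. u f) + (\<Sum>w\<in>W. v w) = matching_value \<alpha> \<mu>"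
    and coal: "\<And>A B. A \<subseteq> F \<Longrightarrow> B \<subseteq> W \<Longrightarrow> coalition_value \<alpha> A B \<le> (\<Sum>f\<in>A. u f) + (\<Sum>w\<in>B. v w)"
    by (auto simp: core_allocation_def feasible_allocation_def)
  have "matching_value \<alpha> \<mu> \<le> (\<Sum>f\<in>F. ?u f) + (\<Sum>w\<in>W. v' w)"
    using d(1) d2 u_nonneg by (intro matching_value_le_dual[OF fin m(1)]) auto
  moreover have coal': "opt_value c A W \<le> (\<Sum>f\<in>A. u f) + (\<Sum>w\<in>W. v w)" if "A \<subseteq> F" for A
  proof -
    have "card A \<le> card W" using that fin card by (metis card_mono)
    moreover have "finite A" using that fin finite_subset by blast
    ultimately show ?thesis
      using opt_value_le_coalition_value[of A W \<alpha>] coal[OF that order_refl] fin unfolding c_def by simp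
  qed
  ultimately have total: "(\<Sum>f\<in>F. u f) + (\<Sum>w\<in>W. v w) = opt_value c F W"
    using m d(3) coal'[of F] by simp
  have "u f = ?u f" if f: "f \<in> F" for f
  proof (rule antisym)
    have "opt_value c (F - {f}) W \<le> (\<Sum>g\<in>F - {f}. u g) + (\<Sum>w\<in>W. v w)"
      by (rule coal') auto
    thus "u f \<le> ?u f"
      using total fin f by (simp add: marginal_def sum.remove[of F f u])
    show "?u f \<le> u f"
      using opt core' f unfolding firm_optimal_core_allocation_def by auto
  qed
  thus ?thesis using total by simp
qed

text \<open>Depends on the matrix alone, so expectations can be computed without choosing a core
  allocation at each sample point.\<close>

definition total_salary :: "('f \<times> 'w \<Rightarrow> real) \<Rightarrow> 'f set \<Rightarrow> 'w set \<Rightarrow> real" where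
  "total_salary c F W = opt_value c F W - (\<Sum>f\<in>F. marginal c F W f)"

lemma total_salary_cong:
  assumes "\<And>f w. f \<in> F \<Longrightarrow> w \<in> W \<Longrightarrow> c (f, w) = c' (f, w)"
  shows "total_salary c F W = total_salary c' F W"
  unfolding total_salary_def
  by (intro arg_cong2[where f = "(-)"] opt_value_cong sum.cong marginal_cong) (auto intro: assms)

lemma total_salary_dual:
  assumes "finite F" "finite W" "card F = card W" "\<And>f w. f \<in> F \<Longrightarrow> w \<in> W \<Longrightarrow> 0 \<le> c (f, w)"
  obtains v where "\<And>w. w \<in> W \<Longrightarrow> 0 \<le> v w"
    "\<And>f w. f \<in> F \<Longrightarrow> w \<in> W \<Longrightarrow> c (f, w) \<le> marginal c F W f + v w"
    "(\<Sum>w\<in>W. v w) = total_salary c F W"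
proof -
  note wit = that
  show thesis
  proof (rule marginal_dual[where c = c, OF assms(1-3)])
    show "0 \<le> c (f, w)" if "f \<in> F" "w \<in> W" for f w using assms(4) that .
    show thesis if "\<And>w. w \<in> W \<Longrightarrow> 0 \<le> v w"
      "\<And>f w. f \<in> F \<Longrightarrow> w \<in> W \<Longrightarrow> c (f, w) \<le> marginal c F W f + v w"
      "(\<Sum>f\<in>F. marginal c F W f) + (\<Sum>w\<in>W. v w) = opt_value c F W" for v
      by (rule wit[OF that(1,2)]) (use that(3) in \<open>simp_all add: total_salary_def\<close>)
  qed
qed

lemma total_salary_nonneg:
  assumes "finite F" "finite W" "card F = card W" "\<And>f w. f \<in> F \<Longrightarrow> w \<in> W \<Longrightarrow> 0 \<le> c (f, w)"
  shows "0 \<le> total_salary c F W"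
proof -
  obtain v where v: "\<And>w. w \<in> W \<Longrightarrow> 0 \<le> v w" "(\<Sum>w\<in>W. v w) = total_salary c F W"
    by (rule total_salary_dual[where c = c, OF assms(1-3)]) (rule assms(4), assumption+, rule that)
  thus ?thesis using sum_nonneg[of W v] by simp
qed

text \<open>By stability, an entry of at least \<open>2 * \<delta>\<close> in the row of
  \<open>f\<close> forces a salary of at least \<open>\<delta>\<close>. The total salary allows this
  for fewer than half of the workers.\<close>

lemma row_small_if_marginal_small:
  assumes "finite F" "finite W" "card F = card W" "\<And>f w. f \<in> F \<Longrightarrow> w \<in> W \<Longrightarrow> 0 \<le> c (f, w)"
    and "f \<in> F" "marginal c F W f < \<delta>" "0 < \<delta>" "2 * total_salary c F W < \<delta> * real (card W)"
  obtains T where "T \<subseteq> W" "card W \<le> 2 * card T" "\<And>w. w \<in> T \<Longrightarrow> c (f, w) < 2 * \<delta>"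
proof -
  obtain v where v: "\<And>w. w \<in> W \<Longrightarrow> 0 \<le> v w"
    "\<And>f w. f \<in> F \<Longrightarrow> w \<in> W \<Longrightarrow> c (f, w) \<le> marginal c F W f + v w"
    "(\<Sum>w\<in>W. v w) = total_salary c F W"
    by (rule total_salary_dual[where c = c, OF assms(1-3)]) (rule assms(4), assumption+, rule that)
  define T where "T = {w \<in> W. c (f, w) < 2 * \<delta>}"
  have T: "T \<subseteq> W" by (auto simp: T_def)
  have "\<delta> * real (card (W - T)) = (\<Sum>w\<in>W - T. \<delta>)" by simp
  also have "\<dots> \<le> (\<Sum>w\<in>W - T. v w)"
  proof (rule sum_mono)
    fix w assume w: "w \<in> W - T"
    hence "2 * \<delta> \<le> c (f, w)" by (auto simp: T_def)
    thus "\<delta> \<le> v w" using v(2)[OF assms(5), of w] w assms(6) by auto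
  qed
  also have "\<dots> \<le> (\<Sum>w\<in>W. v w)"
    using assms(2) v(1) by (intro sum_mono2) auto
  also have "\<dots> = total_salary c F W" by (rule v(3))
  finally have "\<delta> * (2 * real (card (W - T))) < \<delta> * real (card W)" using assms(8) by simp
  hence "2 * card (W - T) < card W" using assms(7) by simp
  moreover have "card (W - T) = card W - card T"
    using T assms(2) finite_subset by (intro card_Diff_subset) auto
  ultimately have "card W \<le> 2 * card T" by simp
  thus thesis using T by (intro that[of T]) (auto simp: T_def)
qed

lemma coalition_value_ge:
  assumes "finite A" "finite B" "is_matching A B \<mu>"
  shows "matching_value \<alpha> \<mu> \<le> coalition_value \<alpha> A B"
  unfolding coalition_value_def using assms finite_matchings[OF assms(1,2)] by (intro Max_ge) auto

lemma coalition_value_attained: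
  assumes "finite A" "finite B"
  obtains \<mu> where "is_matching A B \<mu>" "coalition_value \<alpha> A B = matching_value \<alpha> \<mu>"
proof -
  have "{\<mu>. is_matching A B \<mu>} \<noteq> {}"
    by (auto simp: is_matching_def intro!: exI[of _ "{}"])
  hence "coalition_value \<alpha> A B \<in> matching_value \<alpha> ` {\<mu>. is_matching A B \<mu>}"
    unfolding coalition_value_def using finite_matchings[OF assms] by (intro Max_in) auto
  thus thesis using that by auto
qed

text \<open>Pairs of negative value can be deleted from a matching.\<close>

lemma coalition_value_max_0:
  assumes "finite A" "finite B"
  shows "coalition_value (\<lambda>f w. max 0 (\<alpha> f w)) A B = coalition_value \<alpha> A B"
proof (rule antisym)
  let ?\<beta> = "\<lambda>f w. max 0 (\<alpha> f w)"
  obtain \<mu> where m: "is_matching A B \<mu>" "coalition_value ?\<beta> A B = matching_value ?\<beta> \<mu>"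
    using coalition_value_attained[OF assms] by blast
  have fin: "finite \<mu>" using m(1) assms by (auto simp: is_matching_def intro: finite_subset)
  define \<nu> where "\<nu> = {p \<in> \<mu>. 0 \<le> \<alpha> (fst p) (snd p)}"
  have "is_matching A B \<nu>"
    using m(1) by (auto simp: is_matching_def \<nu>_def intro: inj_on_subset)
  hence "matching_value \<alpha> \<nu> \<le> coalition_value \<alpha> A B"
    by (rule coalition_value_ge[OF assms])
  moreover have "matching_value \<alpha> \<nu> = matching_value ?\<beta> \<mu>"
    unfolding matching_value_def \<nu>_def using fin
    by (intro sum.mono_neutral_cong_left) (auto split: prod.splits)
  ultimately show "coalition_value ?\<beta> A B \<le> coalition_value \<alpha> A B" using m(2) by simp
next
  let ?\<beta> = "\<lambda>f w. max 0 (\<alpha> f w)"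
  obtain \<mu> where m: "is_matching A B \<mu>" "coalition_value \<alpha> A B = matching_value \<alpha> \<mu>"
    using coalition_value_attained[OF assms] by blast
  have "matching_value \<alpha> \<mu> \<le> matching_value ?\<beta> \<mu>"
    unfolding matching_value_def by (intro sum_mono) auto
  also have "\<dots> \<le> coalition_value ?\<beta> A B" by (rule coalition_value_ge[OF assms m(1)])
  finally show "coalition_value \<alpha> A B \<le> coalition_value ?\<beta> A B" using m(2) by simp
qed

text \<open>Core payoffs depend on the matrix only through the coalition values. The matching has to
  be replaced by one that is optimal for the new matrix.\<close>

lemma core_allocation_change_matrix:
  assumes fin: "finite F" "finite W" and core: "core_allocation F W \<alpha> (\<mu>, u, v)"
    and eq: "\<And>A B. A \<subseteq> F \<Longrightarrow> B \<subseteq> W \<Longrightarrow> coalition_value \<beta> A B = coalition_value \<alpha> A B"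
  obtains \<mu>' where "core_allocation F W \<beta> (\<mu>', u, v)"
proof -
  obtain \<nu> where n: "is_matching F W \<nu>" "coalition_value \<beta> F W = matching_value \<beta> \<nu>"
    using coalition_value_attained[OF fin] by blast
  have m: "is_matching F W \<mu>" and sum: "(\<Sum>f\<in>F. u f) + (\<Sum>w\<in>W. v w) = matching_value \<alpha> \<mu>"
    and coal: "\<And>A B. A \<subseteq> F \<and> B \<subseteq> W \<Longrightarrow> coalition_value \<alpha> A B \<le> (\<Sum>f\<in>A. u f) + (\<Sum>w\<in>B. v w)"
    using core by (auto simp: core_allocation_def feasible_allocation_def)
  have "coalition_value \<alpha> F W \<le> matching_value \<alpha> \<mu>"
    using coal[of F W] sum by simp
  hence "matching_value \<alpha> \<mu> = coalition_value \<alpha> F W"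
    using coalition_value_ge[OF fin m, of \<alpha>] by simp
  also have "\<dots> = matching_value \<beta> \<nu>" using n(2) eq[of F W] by simp
  finally have "feasible_allocation F W \<beta> (\<nu>, u, v)"
    using sum n(1) by (simp add: feasible_allocation_def)
  moreover have "coalition_value \<beta> A B \<le> (\<Sum>f\<in>A. u f) + (\<Sum>w\<in>B. v w)" if "A \<subseteq> F \<and> B \<subseteq> W" for A B
    using coal[OF that] eq that by simp
  ultimately have "core_allocation F W \<beta> (\<nu>, u, v)"
    unfolding core_allocation_def by simp
  thus thesis by (rule that)
qed

lemma firm_optimal_total_salary:
  assumes fin: "finite F" "finite W" and card: "card F = card W"
    and opt: "firm_optimal_core_allocation F W \<alpha> (\<mu>, u, v)"
  shows "(\<Sum>w\<in>W. v w) = total_salary (\<lambda>(f, w). max 0 (\<alpha> f w)) F W"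
proof -
  let ?\<beta> = "\<lambda>f w. max 0 (\<alpha> f w)"
  have eq: "coalition_value ?\<beta> A B = coalition_value \<alpha> A B" if "A \<subseteq> F" "B \<subseteq> W" for A B
    using finite_subset[OF that(1) fin(1)] finite_subset[OF that(2) fin(2)]
    by (rule coalition_value_max_0)
  have core: "core_allocation F W \<alpha> (\<mu>, u, v)"
    and best: "\<And>\<mu>' u' v'. core_allocation F W \<alpha> (\<mu>', u', v') \<Longrightarrow> (\<forall>f\<in>F. u' f \<le> u f) \<and> (\<forall>w\<in>W. v w \<le> v' w)"
    using opt by (auto simp: firm_optimal_core_allocation_def)
  obtain \<nu> where n: "core_allocation F W ?\<beta> (\<nu>, u, v)"
    using core_allocation_change_matrix[OF fin core eq] by blast
  have "firm_optimal_core_allocation F W ?\<beta> (\<nu>, u, v)"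
    unfolding firm_optimal_core_allocation_def prod.case
  proof (intro conjI n allI impI)
    fix \<mu>' u' v' assume "core_allocation F W ?\<beta> (\<mu>', u', v')"
    then obtain \<mu>'' where "core_allocation F W \<alpha> (\<mu>'', u', v')"
      by (rule core_allocation_change_matrix[OF fin]) (auto simp: eq)
    thus "\<forall>f\<in>F. u' f \<le> u f" "\<forall>w\<in>W. v w \<le> v' w" using best by blast+
  qed
  from firm_optimal_salaries[OF fin card _ this] show ?thesis
    by (simp add: total_salary_def)
qed

section \<open>Uniform matrices\<close>

definition unif :: "real measure" where
  "unif = uniform_measure lborel {0..1}"

text \<open>Infinitely many columns on one space: every rectangular submarket and any number of
  fresh columns are available at once.\<close>

definition iid :: "('f \<times> nat \<Rightarrow> real) measure" where
  "iid = PiM UNIV (\<lambda>_. unif)"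

lemma prob_space_unif: "prob_space unif"
  unfolding unif_def by (rule prob_space_uniform_measure) auto

lemma sets_unif [measurable_cong, simp]: "sets unif = sets borel"
  by (simp add: unif_def)

lemma space_unif [simp]: "space unif = UNIV"
  by (simp add: unif_def)

interpretation unif: prob_space unif by (rule prob_space_unif)

interpretation iid: product_prob_space "\<lambda>_. unif" UNIV
  by (intro product_prob_spaceI prob_space_unif)

lemma prob_space_iid: "prob_space iid"
  unfolding iid_def by (rule iid.P.prob_space_axioms)

interpretation iid_prob: prob_space iid by (rule prob_space_iid)

lemma space_iid [simp]: "space iid = UNIV"
  by (simp add: iid_def space_PiM)

lemma measure_iid_UNIV [simp]: "measure iid UNIV = 1"
  using iid_prob.prob_space by simp

lemma measurable_entry [measurable]: "(\<lambda>\<omega>. \<omega> p) \<in> borel_measurable iid"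
  unfolding iid_def by measurable

lemma emeasure_unif_atMost: "0 \<le> t \<Longrightarrow> t \<le> 1 \<Longrightarrow> emeasure unif {..t} = ennreal t"
proof -
  assume "0 \<le> t" "t \<le> 1"
  hence "{0..1} \<inter> {..t} = {0..t}" by auto
  thus ?thesis using \<open>0 \<le> t\<close> by (simp add: unif_def emeasure_uniform_measure divide_ennreal_def)
qed

lemma emeasure_unif_lessThan: "0 \<le> t \<Longrightarrow> t \<le> 1 \<Longrightarrow> emeasure unif {..<t} = ennreal t"
proof -
  assume "0 \<le> t" "t \<le> 1"
  hence "{0..1} \<inter> {..<t} = {0..<t}" by auto
  thus ?thesis using \<open>0 \<le> t\<close> by (simp add: unif_def emeasure_uniform_measure divide_ennreal_def)
qed

lemma AE_unif: "AE x in unif. 0 < x \<and> x < 1"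
proof -
  have "AE x in lborel. x \<noteq> (0::real)" "AE x in lborel. x \<noteq> (1::real)"
    by (auto intro: AE_lborel_singleton)
  hence "AE x in lborel. x \<in> {0..1::real} \<longrightarrow> 0 < x \<and> x < 1"
    by eventually_elim auto
  thus ?thesis unfolding unif_def by (intro AE_uniform_measureI) auto
qed

lemma AE_entries:
  assumes "finite A" "finite B"
  shows "AE \<omega> in iid. \<forall>f\<in>A. \<forall>w\<in>B. 0 < \<omega> (f, w) \<and> \<omega> (f, w) < 1"
proof -
  have "AE \<omega> in iid. 0 < \<omega> p \<and> \<omega> p < 1" for p :: "'a \<times> nat"
    unfolding iid_def by (rule AE_PiM_component[OF prob_space_unif _ AE_unif]) auto
  thus ?thesis using assms by (intro AE_finite_allI) auto
qed

lemma measurable_opt_value: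
  assumes "finite A" "finite B"
    and "\<And>f w. f \<in> A \<Longrightarrow> w \<in> B \<Longrightarrow> (\<lambda>x. C x (f, w)) \<in> borel_measurable N"
  shows "(\<lambda>x. opt_value (C x) A B) \<in> borel_measurable N"
  unfolding opt_value_def
proof (intro borel_measurable_Max borel_measurable_sum finite_injections assms)
  fix \<sigma> f assume "\<sigma> \<in> injections A B" "f \<in> A"
  thus "\<sigma> f \<in> B" by (auto simp: injections_def)
qed

lemma measurable_marginal:
  assumes "finite A" "finite B"
    and "\<And>f w. f \<in> A \<Longrightarrow> w \<in> B \<Longrightarrow> (\<lambda>x. C x (f, w)) \<in> borel_measurable N"
  shows "(\<lambda>x. marginal (C x) A B f) \<in> borel_measurable N"
  unfolding marginal_def using assms
  by (intro borel_measurable_diff measurable_opt_value) auto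

lemma measurable_opt_value_iid [measurable]:
  "finite A \<Longrightarrow> finite B \<Longrightarrow> (\<lambda>\<omega>. opt_value \<omega> A B) \<in> borel_measurable iid"
  by (rule measurable_opt_value) auto

lemma measurable_marginal_iid [measurable]:
  "finite A \<Longrightarrow> finite B \<Longrightarrow> (\<lambda>\<omega>. marginal \<omega> A B f) \<in> borel_measurable iid"
  by (rule measurable_marginal) auto

lemma AE_marginal:
  assumes "finite A" "finite B" "card A \<le> card B"
  shows "AE \<omega> in iid. \<forall>f\<in>A. 0 < marginal \<omega> A B f \<and> marginal \<omega> A B f \<le> 1"
  using AE_entries[OF assms(1,2)]
proof eventually_elim
  case (elim \<omega>)
  show ?case
  proof
    fix f assume f: "f \<in> A"
    obtain w where "w \<in> B" "marginal \<omega> A B f \<le> \<omega> (f, w)"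
      using marginal_le_entry[OF assms(1,2) f assms(3)] by blast
    moreover have "0 < marginal \<omega> A B f"
      using elim f by (intro marginal_pos[OF assms(1,2) f assms(3)]) auto
    ultimately show "0 < marginal \<omega> A B f \<and> marginal \<omega> A B f \<le> 1"
      using elim f by fastforce
  qed
qed

lemma nn_integral_iid_restrict:
  assumes "finite I" "g \<in> borel_measurable (PiM I (\<lambda>_. unif))"
  shows "(\<integral>\<^sup>+\<omega>. g (restrict \<omega> I) \<partial>iid) = (\<integral>\<^sup>+\<omega>. g \<omega> \<partial>PiM I (\<lambda>_. unif))"
proof -
  have "(\<integral>\<^sup>+\<omega>. g \<omega> \<partial>PiM I (\<lambda>_. unif))
      = (\<integral>\<^sup>+\<omega>. g \<omega> \<partial>distr iid (PiM I (\<lambda>_. unif)) (\<lambda>\<omega>. restrict \<omega> I))"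
    using assms(1) by (simp add: iid_def iid.distr_PiM_restrict_finite)
  also have "\<dots> = (\<integral>\<^sup>+\<omega>. g (restrict \<omega> I) \<partial>iid)"
    using assms(2) unfolding iid_def by (intro nn_integral_distr measurable_restrict_subset) auto
  finally show ?thesis by simp
qed

text \<open>
  Conditionally on the columns in \<open>B\<close>, which determine the marginals, the columns in \<open>X\<close> are
  still uniform. The set \<open>S t\<close> will be \<open>{..t}\<close> or \<open>{..<t}\<close>.
\<close>
lemma emeasure_new_columns:
  fixes A :: "'f set" and S :: "real \<Rightarrow> real set"
  assumes fin: "finite A" "finite B" "finite X" and disj: "B \<inter> X = {}" and card: "card A \<le> card B"
    and S: "Measurable.pred (borel \<Otimes>\<^sub>M borel) (\<lambda>(x, t). x \<in> S t)"
      "\<And>t. 0 \<le> t \<Longrightarrow> t \<le> 1 \<Longrightarrow> emeasure unif (S t) = ennreal t"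
  shows "emeasure iid {\<omega>. \<forall>f\<in>A. \<forall>x\<in>X. \<omega> (f, x) \<in> S (marginal \<omega> A B f)}
       = (\<integral>\<^sup>+\<omega>. ennreal ((\<Prod>f\<in>A. marginal \<omega> A B f) ^ card X) \<partial>iid)"
proof -
  define I J where "I = A \<times> B" and "J = A \<times> X"
  have IJ: "I \<inter> J = {}" "finite I" "finite J" using fin disj by (auto simp: I_def J_def)
  define E where "E \<omega> \<longleftrightarrow> (\<forall>f\<in>A. \<forall>x\<in>X. \<omega> (f, x) \<in> S (marginal \<omega> A B f))" for \<omega>
  \<comment> \<open>\<open>H\<close> is the conditional probability of \<open>E\<close> given the
    columns in \<open>B\<close>.\<close>
  define H where "H \<omega> = (\<Prod>(f, x)\<in>J. emeasure unif (S (marginal \<omega> A B f)))" for \<omega>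
  have St [measurable]: "S t \<in> sets borel" for t
  proof -
    have "Measurable.pred borel (\<lambda>x. case (x, t) of (x, t) \<Rightarrow> x \<in> S t)"
      by (rule measurable_compose[OF _ S(1)]) simp
    thus ?thesis by (simp add: pred_def)
  qed
  have Sm: "Measurable.pred N (\<lambda>\<omega>. g \<omega> \<in> S (h \<omega>))"
    if "g \<in> borel_measurable N" "h \<in> borel_measurable N" for g h :: "('f \<times> nat \<Rightarrow> real) \<Rightarrow> real" and N
    using measurable_compose[OF measurable_Pair[OF that] S(1)] by simp
  have entry: "(\<lambda>\<omega>. \<omega> p) \<in> borel_measurable (PiM K (\<lambda>_. unif))" if "p \<in> K" for p K
    using measurable_component_singleton[OF that, of "\<lambda>_. unif"] by (simp cong: measurable_cong_sets)
  have marg: "(\<lambda>\<omega>. marginal \<omega> A B f) \<in> borel_measurable (PiM K (\<lambda>_. unif))" if "I \<subseteq> K" for f K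
    using that fin by (intro measurable_marginal entry) (auto simp: I_def)
  have E_meas: "Measurable.pred (PiM K (\<lambda>_. unif)) E" if "I \<union> J \<subseteq> K" for K
  proof -
    have "Measurable.pred (PiM K (\<lambda>_. unif)) (\<lambda>\<omega>. \<omega> (f, x) \<in> S (marginal \<omega> A B f))"
      if "f \<in> A" "x \<in> X" for f x
      using that \<open>I \<union> J \<subseteq> K\<close> by (intro Sm entry marg) (auto simp: J_def)
    thus ?thesis unfolding E_def using fin by measurable
  qed
  have E_restr: "E (restrict \<omega> (I \<union> J)) \<longleftrightarrow> E \<omega>" for \<omega>
  proof -
    have "marginal (restrict \<omega> (I \<union> J)) A B f = marginal \<omega> A B f" for f
      by (rule marginal_cong) (auto simp: I_def)
    thus ?thesis by (auto simp: E_def J_def)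
  qed
  have H_restr: "H (restrict \<omega> I) = H \<omega>" for \<omega>
  proof -
    have "marginal (restrict \<omega> I) A B f = marginal \<omega> A B f" for f
      by (rule marginal_cong) (auto simp: I_def)
    thus ?thesis by (auto simp: H_def)
  qed
  have inner: "(\<integral>\<^sup>+y. indicator {\<omega>. E \<omega>} (merge I J (x, y)) \<partial>PiM J (\<lambda>_. unif)) = H x"
    if "x \<in> space (PiM I (\<lambda>_. unif))" for x
  proof -
    have mm: "merge I J (x, y) (f, b) = x (f, b)" if "f \<in> A" "b \<in> B" for y f b
      using that by (simp add: merge_def I_def)
    have mm': "merge I J (x, y) (f, b) = y (f, b)" if "f \<in> A" "b \<in> X" for y f b
      using that disj by (auto simp: merge_def I_def J_def)
    have "marginal (merge I J (x, y)) A B f = marginal x A B f" for y f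
      by (rule marginal_cong) (auto simp: mm)
    hence "E (merge I J (x, y)) \<longleftrightarrow> (\<forall>f\<in>A. \<forall>b\<in>X. y (f, b) \<in> S (marginal x A B f))" for y
      by (simp add: E_def mm')
    hence "E (merge I J (x, y)) \<longleftrightarrow> (\<forall>p\<in>J. y p \<in> S (marginal x A B (fst p)))" for y
      by (auto simp: J_def)
    hence "(\<integral>\<^sup>+y. indicator {\<omega>. E \<omega>} (merge I J (x, y)) \<partial>PiM J (\<lambda>_. unif)) =
       (\<integral>\<^sup>+y. indicator (Pi\<^sub>E J (\<lambda>p. S (marginal x A B (fst p)))) y \<partial>PiM J (\<lambda>_. unif))"
      by (intro nn_integral_cong) (auto simp: indicator_def space_PiM PiE_iff)
    also have "\<dots> = (\<Prod>p\<in>J. emeasure unif (S (marginal x A B (fst p))))"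
      using IJ by (subst nn_integral_indicator) (auto intro!: iid.emeasure_PiM sets_PiM_I_finite)
    finally show ?thesis by (simp add: H_def case_prod_beta)
  qed
  have Hm: "H \<in> borel_measurable (PiM I (\<lambda>_. unif))"
  proof -
    \<comment> \<open>Measurability in the threshold follows from that of the masses of the sections
      of a product set.\<close>
    have "(\<lambda>t. emeasure unif (S t)) \<in> borel_measurable borel"
    proof -
      have "(\<lambda>t. emeasure unif (Pair t -` {p \<in> space (borel \<Otimes>\<^sub>M unif). snd p \<in> S (fst p)})) \<in> borel_measurable borel"
      proof (rule unif.measurable_emeasure_Pair)
        have "Measurable.pred (borel \<Otimes>\<^sub>M borel) (\<lambda>p. case (snd p, fst p) of (x, t) \<Rightarrow> x \<in> S t)"
          by (rule measurable_compose[OF _ S(1)]) measurable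
        hence "{p \<in> space (borel \<Otimes>\<^sub>M borel). snd p \<in> S (fst p)} \<in> sets (borel \<Otimes>\<^sub>M borel)"
          by (simp add: pred_def)
        moreover have "sets (borel \<Otimes>\<^sub>M unif) = sets (borel \<Otimes>\<^sub>M (borel :: real measure))"
          by (intro sets_pair_measure_cong) auto
        ultimately show "{p \<in> space (borel \<Otimes>\<^sub>M unif). snd p \<in> S (fst p)} \<in> sets (borel \<Otimes>\<^sub>M unif)"
          by (simp add: space_pair_measure)
      qed
      thus ?thesis by (simp add: space_pair_measure vimage_def)
    qed
    thus ?thesis
      unfolding H_def by (intro borel_measurable_prod_ennreal) (auto intro!: measurable_compose[OF marg])
  qed
  have "emeasure iid {\<omega>. E \<omega>} = (\<integral>\<^sup>+\<omega>. indicator {\<omega>. E \<omega>} \<omega> \<partial>iid)"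
    using E_meas[of UNIV] by (subst nn_integral_indicator) (auto simp: pred_def iid_def space_PiM)
  also have "\<dots> = (\<integral>\<^sup>+\<omega>. indicator {\<omega>. E \<omega>} (restrict \<omega> (I \<union> J)) \<partial>iid)"
    by (simp add: indicator_def E_restr)
  also have "\<dots> = (\<integral>\<^sup>+\<omega>. indicator {\<omega>. E \<omega>} \<omega> \<partial>PiM (I \<union> J) (\<lambda>_. unif))"
    using IJ E_meas[of "I \<union> J"]
    by (intro nn_integral_iid_restrict) (auto simp: indicator_def intro!: measurable_If)
  also have "\<dots> = (\<integral>\<^sup>+x. (\<integral>\<^sup>+y. indicator {\<omega>. E \<omega>} (merge I J (x, y)) \<partial>PiM J (\<lambda>_. unif)) \<partial>PiM I (\<lambda>_. unif))"
    using IJ E_meas[of "I \<union> J"]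
    by (intro iid.product_nn_integral_fold) (auto simp: indicator_def intro!: measurable_If)
  also have "\<dots> = (\<integral>\<^sup>+x. H x \<partial>PiM I (\<lambda>_. unif))"
    by (intro nn_integral_cong inner)
  also have "\<dots> = (\<integral>\<^sup>+x. H x \<partial>iid)"
    using nn_integral_iid_restrict[OF IJ(2) Hm] by (simp add: H_restr)
  also have "\<dots> = (\<integral>\<^sup>+\<omega>. ennreal ((\<Prod>f\<in>A. marginal \<omega> A B f) ^ card X) \<partial>iid)"
    using AE_marginal[OF fin(1,2) card]
  proof (intro nn_integral_cong_AE, eventually_elim)
    case (elim \<omega>)
    have "H \<omega> = (\<Prod>f\<in>A. \<Prod>x\<in>X. ennreal (marginal \<omega> A B f))"
      unfolding H_def J_def using fin elim
      by (subst prod.cartesian_product[symmetric]) (auto intro!: prod.cong simp: S(2) less_imp_le)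
    also have "\<dots> = ennreal ((\<Prod>f\<in>A. marginal \<omega> A B f) ^ card X)"
      using elim by (simp add: prod_ennreal less_imp_le prod_power_distrib ennreal_power prod_nonneg)
    finally show ?case .
  qed
  finally show ?thesis by (simp add: E_def)
qed

section \<open>Exchangeability of the columns and moments of the product of marginals\<close>

lemma obtain_column_permutation:
  fixes B B' Y :: "'w set"
  assumes "finite Y" "B \<subseteq> Y" "B' \<subseteq> Y" "card B = card B'"
  obtains \<pi> where "bij \<pi>" "\<pi> ` Y = Y" "\<pi> ` B = B'"
proof -
  have fin: "finite B" "finite B'" using assms finite_subset by blast+
  obtain h where h: "bij_betw h B B'"
    using fin assms(4) finite_same_card_bij by blast
  have "card (Y - B) = card (Y - B')"
    using assms fin by (simp add: card_Diff_subset)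
  then obtain k where k: "bij_betw k (Y - B) (Y - B')"
    using assms(1) finite_same_card_bij by (metis finite_Diff)
  define \<pi> where "\<pi> w = (if w \<in> Y then if w \<in> B then h w else k w else w)" for w
  have 1: "bij_betw \<pi> B B'"
    using h assms by (subst bij_betw_cong[of B \<pi> h]) (auto simp: \<pi>_def)
  have "bij_betw \<pi> (Y - B) (Y - B')"
    using k by (subst bij_betw_cong[of _ \<pi> k]) (auto simp: \<pi>_def)
  with 1 have 2: "bij_betw \<pi> (B \<union> (Y - B)) (B' \<union> (Y - B'))"
    by (rule bij_betw_combine) auto
  have eq: "B \<union> (Y - B) = Y" "B' \<union> (Y - B') = Y" using assms by auto
  have "bij_betw \<pi> (- Y) (- Y)"
    by (subst bij_betw_cong[of _ \<pi> id]) (auto simp: \<pi>_def)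
  with 2 have "bij_betw \<pi> (Y \<union> - Y) (Y \<union> - Y)"
    unfolding eq by (rule bij_betw_combine) auto
  hence "bij \<pi>" by simp
  thus ?thesis
    using that 1 2 unfolding eq by (auto simp: bij_betw_def)
qed

text \<open>A permutation of the columns that maps \<open>Y\<close> to itself and \<open>B\<close>
  to \<open>B'\<close> preserves the law of the matrix.\<close>

lemma prob_optimum_in_columns_eq:
  assumes "finite A" "finite Y" "B \<subseteq> Y" "B' \<subseteq> Y" "card B = card B'"
  shows "iid_prob.prob {\<omega>. opt_value \<omega> A Y = opt_value \<omega> A B}
       = iid_prob.prob {\<omega>. opt_value \<omega> A Y = opt_value \<omega> A B'}"
proof -
  have fin: "finite B" "finite B'" using assms finite_subset by blast+
  obtain \<pi> where p: "bij \<pi>" "\<pi> ` Y = Y" "\<pi> ` B = B'"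
    using obtain_column_permutation[OF assms(2-5)] by blast
  have inj: "inj \<pi>" using p by (simp add: bij_is_inj)
  define T where "T \<omega> = (\<lambda>(f, w). \<omega> (f, \<pi> w))" for \<omega> :: "'a \<times> nat \<Rightarrow> real"
  have "distr iid (PiM UNIV (\<lambda>_. unif)) (\<lambda>\<omega> :: 'a \<times> nat \<Rightarrow> real. \<lambda>n\<in>UNIV. \<omega> ((\<lambda>(f, w). (f, \<pi> w)) n)) = PiM UNIV (\<lambda>_. unif)"
    unfolding iid_def using inj
    by (intro distr_PiM_reindex prob_space_unif) (auto simp: inj_on_def)
  moreover have "(\<lambda>\<omega>. \<lambda>n\<in>UNIV. \<omega> ((\<lambda>(f, w). (f, \<pi> w)) n)) = T"
    by (auto simp: T_def fun_eq_iff)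
  ultimately have T: "distr iid iid T = iid" by (simp add: iid_def)
  have Tm: "T \<in> measurable iid iid"
  proof -
    have "T \<in> measurable iid (PiM UNIV (\<lambda>_. unif))"
      by (rule measurable_PiM_single') (auto simp: T_def case_prod_beta intro!: measurable_entry
          cong: measurable_cong_sets)
    thus ?thesis by (simp add: iid_def)
  qed
  have m: "{\<omega>. opt_value \<omega> A Y = opt_value \<omega> A B} \<in> sets (iid :: ('a \<times> nat \<Rightarrow> real) measure)" if "finite B" for B
  proof -
    have "{\<omega> \<in> space iid. opt_value \<omega> A Y = opt_value \<omega> A B} \<in> sets (iid :: ('a \<times> nat \<Rightarrow> real) measure)"
      using assms that by measurable
    thus ?thesis by simp
  qed
  have "iid_prob.prob {\<omega>. opt_value \<omega> A Y = opt_value \<omega> A B}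
      = measure (distr iid iid T) {\<omega>. opt_value \<omega> A Y = opt_value \<omega> A B}"
    by (simp add: T)
  also have "\<dots> = iid_prob.prob {\<omega>. opt_value (T \<omega>) A Y = opt_value (T \<omega>) A B}"
    using m fin by (subst measure_distr[OF Tm]) (auto simp: vimage_def)
  also have "\<dots> = iid_prob.prob {\<omega>. opt_value \<omega> A Y = opt_value \<omega> A B'}"
  proof -
    have "opt_value (T \<omega>) A C = opt_value \<omega> A (\<pi> ` C)" for \<omega> C
      unfolding T_def by (rule opt_value_reindex[OF inj])
    thus ?thesis using p by simp
  qed
  finally show ?thesis .
qed

lemma card_subsets_containing:
  assumes "finite Y" "S \<subseteq> Y" "card S \<le> n"
  shows "card {B. B \<subseteq> Y \<and> card B = n \<and> S \<subseteq> B} = (card Y - card S) choose (n - card S)"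
proof -
  have finS: "finite S" using assms finite_subset by blast
  have "bij_betw (\<lambda>B. B - S) {B. B \<subseteq> Y \<and> card B = n \<and> S \<subseteq> B} {D. D \<subseteq> Y - S \<and> card D = n - card S}"
  proof (rule bij_betwI[where g = "\<lambda>D. D \<union> S"])
    show "(\<lambda>B. B - S) \<in> {B. B \<subseteq> Y \<and> card B = n \<and> S \<subseteq> B} \<rightarrow> {D. D \<subseteq> Y - S \<and> card D = n - card S}"
      using finS by (auto simp: card_Diff_subset)
    show "(\<lambda>D. D \<union> S) \<in> {D. D \<subseteq> Y - S \<and> card D = n - card S} \<rightarrow> {B. B \<subseteq> Y \<and> card B = n \<and> S \<subseteq> B}"
    proof
      fix D assume D: "D \<in> {D. D \<subseteq> Y - S \<and> card D = n - card S}"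
      hence "finite D" using assms finite_subset[of D Y] by auto
      hence "card (D \<union> S) = n"
        using D finS assms by (subst card_Un_disjoint) auto
      thus "D \<union> S \<in> {B. B \<subseteq> Y \<and> card B = n \<and> S \<subseteq> B}" using D assms by auto
    qed
  qed auto
  hence "card {B. B \<subseteq> Y \<and> card B = n \<and> S \<subseteq> B} = card {D. D \<subseteq> Y - S \<and> card D = n - card S}"
    by (rule bij_betw_same_card)
  also have "\<dots> = card (Y - S) choose (n - card S)"
    using assms by (intro n_subsets) auto
  finally show ?thesis using assms finS by (simp add: card_Diff_subset)
qed

text \<open>
  By exchangeability of the columns, the optimal partners of \<open>A\<close> form a uniformly distributed
  subset, and by independence the probability that they avoid \<open>j\<close> additional columns is the
  \<open>j\<close>-th moment of the product of the marginals. Ties are dealt with by squeezing the count of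
  good \<open>B\<close> between the strict and the weak version of the criterion.
\<close>
lemma moment_marginals:
  assumes fin: "finite A" "finite B" and card: "card A \<le> card B"
  shows "iid_prob.expectation (\<lambda>\<omega>. (\<Prod>f\<in>A. marginal \<omega> A B f) ^ j)
    = real ((card B + j - card A) choose (card B - card A)) / real ((card B + j) choose card B)"
proof -
  define m n where "m = card A" and "n = card B"
  obtain X where X: "finite X" "card X = j" "X \<subseteq> - B"
    using infinite_arbitrarily_large[of "- B" j] fin by auto
  define Y where "Y = B \<union> X"
  have Y: "finite Y" "B \<subseteq> Y" using fin X by (auto simp: Y_def)
  have cY: "card Y = n + j" unfolding Y_def n_def using fin X by (subst card_Un_disjoint) auto
  define K where "K = {C. C \<subseteq> Y \<and> card C = n}"
  have finK: "finite K" using Y by (auto simp: K_def)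
  have cK: "card K = (n + j) choose n" using Y cY by (simp add: K_def n_subsets)
  define q where "q = iid_prob.prob {\<omega>. opt_value \<omega> A Y = opt_value \<omega> A B}"
  define z where "z C = iid_prob.expectation (\<lambda>\<omega>. (\<Prod>f\<in>A. marginal \<omega> A C f) ^ j)" for C
  define Weak where "Weak C = {\<omega>. opt_value \<omega> A Y = opt_value \<omega> A C}" for C
  define Unused where "Unused C = {\<omega>. \<forall>f\<in>A. \<forall>x\<in>Y - C. \<omega> (f, x) \<in> {..marginal \<omega> A C f}}" for C
  define Strict where "Strict C = {\<omega>. \<forall>f\<in>A. \<forall>x\<in>Y - C. \<omega> (f, x) \<in> {..<marginal \<omega> A C f}}" for C
  have C: "finite C" "C \<subseteq> Y" "card C = n" "card A \<le> card C" "card (Y - C) = j" if "C \<in> K" for C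
    using that Y cY card by (auto simp: K_def n_def finite_subset card_Diff_subset)
  have ennreal_z: "ennreal (z C) = (\<integral>\<^sup>+\<omega>. ennreal ((\<Prod>f\<in>A. marginal \<omega> A C f) ^ j) \<partial>iid)"
    and z_nonneg: "0 \<le> z C" if "C \<in> K" for C
  proof -
    have ae: "AE \<omega> in iid. 0 \<le> (\<Prod>f\<in>A. marginal \<omega> A C f) ^ j \<and> (\<Prod>f\<in>A. marginal \<omega> A C f) ^ j \<le> 1"
      using AE_marginal[OF fin(1) C(1,4)[OF that]]
    proof eventually_elim
      case (elim \<omega>)
      have "0 \<le> (\<Prod>f\<in>A. marginal \<omega> A C f)"
        by (rule prod_nonneg) (use elim in \<open>auto intro: less_imp_le\<close>)
      moreover have "(\<Prod>f\<in>A. marginal \<omega> A C f) \<le> 1"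
        by (rule prod_le_1) (use elim in \<open>auto intro: less_imp_le\<close>)
      ultimately show ?case by (auto intro: power_le_one)
    qed
    have meas: "(\<lambda>\<omega>. (\<Prod>f\<in>A. marginal \<omega> A C f) ^ j) \<in> borel_measurable iid"
      using fin C(1)[OF that] by measurable
    have "integrable iid (\<lambda>\<omega>. (\<Prod>f\<in>A. marginal \<omega> A C f) ^ j)"
      by (rule iid_prob.integrable_const_bound[where B = 1]) (use ae meas in auto)
    thus "ennreal (z C) = (\<integral>\<^sup>+\<omega>. ennreal ((\<Prod>f\<in>A. marginal \<omega> A C f) ^ j) \<partial>iid)"
      unfolding z_def using ae by (intro nn_integral_eq_integral[symmetric]) auto
    show "0 \<le> z C" unfolding z_def using ae by (intro integral_nonneg_AE) auto
  qed
  have prob_Unused: "iid_prob.prob (Unused C) = z C" if "C \<in> K" for C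
  proof -
    have "emeasure iid (Unused C) = ennreal (z C)"
      unfolding Unused_def ennreal_z[OF that] C(5)[OF that, symmetric]
      using fin Y C[OF that] by (intro emeasure_new_columns) (auto simp: emeasure_unif_atMost)
    thus ?thesis using z_nonneg[OF that] by (simp add: measure_def)
  qed
  have prob_Strict: "iid_prob.prob (Strict C) = z C" if "C \<in> K" for C
  proof -
    have "emeasure iid (Strict C) = ennreal (z C)"
      unfolding Strict_def ennreal_z[OF that] C(5)[OF that, symmetric]
      using fin Y C[OF that] by (intro emeasure_new_columns) (auto simp: emeasure_unif_lessThan)
    thus ?thesis using z_nonneg[OF that] by (simp add: measure_def)
  qed
  have meas_Weak: "Weak C \<in> sets iid" if "C \<in> K" for C
  proof -
    have "{\<omega> \<in> space iid. opt_value \<omega> A Y = opt_value \<omega> A C} \<in> sets iid"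
      using fin Y C(1)[OF that] by measurable
    thus ?thesis by (simp add: Weak_def)
  qed
  have meas_Strict: "Strict C \<in> sets iid" and meas_Unused: "Unused C \<in> sets iid" if "C \<in> K" for C
  proof -
    note marg = measurable_marginal_iid[OF fin(1) C(1)[OF that]]
    have "{\<omega> \<in> space iid. \<forall>f\<in>A. \<forall>x\<in>Y - C. \<omega> (f, x) < marginal \<omega> A C f} \<in> sets iid"
      "{\<omega> \<in> space iid. \<forall>f\<in>A. \<forall>x\<in>Y - C. \<omega> (f, x) \<le> marginal \<omega> A C f} \<in> sets iid"
      using fin Y by (auto intro!: sets.sets_Collect_finite_All borel_measurable_less
          borel_measurable_le measurable_entry marg simp del: space_iid)
    thus "Strict C \<in> sets iid" "Unused C \<in> sets iid" by (simp_all add: Strict_def Unused_def)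
  qed
  have q: "q = iid_prob.prob (Weak C)" if "C \<in> K" for C
    unfolding q_def Weak_def using fin Y C[OF that]
    by (intro prob_optimum_in_columns_eq) (auto simp: n_def)
  have q_le_z: "q \<le> z C" if "C \<in> K" for C
    unfolding q[OF that] prob_Unused[OF that, symmetric]
  proof (rule iid_prob.finite_measure_mono[OF _ meas_Unused[OF that]])
    show "Weak C \<subseteq> Unused C"
      using le_marginal_if_new_workers_useless[OF fin(1) Y(1) C(2,4)[OF that]]
      by (auto simp: Weak_def Unused_def)
  qed
  \<comment> \<open>The number of sets in \<open>K\<close> that contain the range of a fixed optimal
    injection into \<open>Y\<close>. Each \<open>C\<close> whose \<open>Strict\<close> event occurs
    is such a set, and for each such set the \<open>Weak\<close> event occurs.\<close>
  define N where "N = (n + j - m) choose (n - m)"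
  have upper: "(\<Sum>C\<in>K. indicator (Strict C) \<omega>) \<le> real N"
    and lower: "real N \<le> (\<Sum>C\<in>K. indicator (Weak C) \<omega>)" for \<omega>
  proof -
    have "card A \<le> card Y" using card Y card_mono order_trans by blast
    then obtain \<sigma> where s: "inj_on \<sigma> A" "\<sigma> ` A \<subseteq> Y" "opt_value \<omega> A Y = (\<Sum>f\<in>A. \<omega> (f, \<sigma> f))"
      using opt_value_attained[OF fin(1) Y(1)] by metis
    have cs: "card (\<sigma> ` A) = m" using s by (simp add: card_image m_def)
    have cG: "card {C. C \<subseteq> Y \<and> card C = n \<and> \<sigma> ` A \<subseteq> C} = N"
      using card_subsets_containing[OF Y(1) s(2), of n] cs cY card by (simp add: N_def m_def n_def)
    have "{C \<in> K. \<omega> \<in> Strict C} \<subseteq> {C. C \<subseteq> Y \<and> card C = n \<and> \<sigma> ` A \<subseteq> C}"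
    proof
      fix D assume D: "D \<in> {C \<in> K. \<omega> \<in> Strict C}"
      hence "\<sigma> ` A \<subseteq> D"
        using new_workers_unused[OF fin(1) Y(1) C(2,4) _ s] by (auto simp: Strict_def)
      thus "D \<in> {C. C \<subseteq> Y \<and> card C = n \<and> \<sigma> ` A \<subseteq> C}" using D by (auto simp: K_def)
    qed
    hence "card {C \<in> K. \<omega> \<in> Strict C} \<le> N"
      unfolding cG[symmetric] using Y by (intro card_mono) auto
    moreover have "(\<Sum>C\<in>K. indicator (Strict C) \<omega>) = real (card {C \<in> K. \<omega> \<in> Strict C})"
      using finK by (simp add: indicator_def sum.If_cases Int_def)
    ultimately show "(\<Sum>C\<in>K. indicator (Strict C) \<omega>) \<le> real N" by simp
    have "{C. C \<subseteq> Y \<and> card C = n \<and> \<sigma> ` A \<subseteq> C} \<subseteq> {C \<in> K. \<omega> \<in> Weak C}"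
    proof
      fix D assume D: "D \<in> {C. C \<subseteq> Y \<and> card C = n \<and> \<sigma> ` A \<subseteq> C}"
      hence DK: "D \<in> K" by (auto simp: K_def)
      have "opt_value \<omega> A Y \<le> opt_value \<omega> A D"
        unfolding s(3) using fin C[OF DK] D s by (intro opt_value_ge) auto
      moreover have "opt_value \<omega> A D \<le> opt_value \<omega> A Y"
        using fin Y C[OF DK] by (intro opt_value_mono) auto
      ultimately show "D \<in> {C \<in> K. \<omega> \<in> Weak C}" using DK by (auto simp: Weak_def)
    qed
    hence "N \<le> card {C \<in> K. \<omega> \<in> Weak C}"
      unfolding cG[symmetric] using finK by (intro card_mono) auto
    moreover have "(\<Sum>C\<in>K. indicator (Weak C) \<omega>) = real (card {C \<in> K. \<omega> \<in> Weak C})"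
      using finK by (simp add: indicator_def sum.If_cases Int_def)
    ultimately show "real N \<le> (\<Sum>C\<in>K. indicator (Weak C) \<omega>)" by simp
  qed
  have integ: "integrable iid (indicat_real S)" if "S \<in> sets iid" for S :: "('a \<times> nat \<Rightarrow> real) set"
    using that by (intro integrable_real_indicator) (auto simp: less_top[symmetric])
  have "(\<Sum>C\<in>K. z C) = iid_prob.expectation (\<lambda>\<omega>. \<Sum>C\<in>K. indicator (Strict C) \<omega>)"
    using meas_Strict prob_Strict integ
    by (subst Bochner_Integration.integral_sum) (auto intro!: sum.cong)
  also have "\<dots> \<le> iid_prob.expectation (\<lambda>\<omega> :: 'a \<times> nat \<Rightarrow> real. real N)"
    using meas_Strict upper integ
    by (intro integral_mono Bochner_Integration.integrable_sum) auto
  finally have sum_z: "(\<Sum>C\<in>K. z C) \<le> real N" by (simp add: iid_prob.prob_space)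
  have "iid_prob.expectation (\<lambda>\<omega> :: 'a \<times> nat \<Rightarrow> real. real N) \<le> iid_prob.expectation (\<lambda>\<omega>. \<Sum>C\<in>K. indicator (Weak C) \<omega>)"
    using meas_Weak lower integ
    by (intro integral_mono Bochner_Integration.integrable_sum) auto
  also have "\<dots> = (\<Sum>C\<in>K. q)"
    using meas_Weak q integ
    by (subst Bochner_Integration.integral_sum) (auto intro!: sum.cong)
  finally have sum_q: "real N \<le> (\<Sum>C\<in>K. q)" by (simp add: iid_prob.prob_space)
  \<comment> \<open>The sum of \<open>z\<close> is at most \<open>N\<close>, which is at most the
    sum of \<open>q\<close>, although \<open>q \<le> z C\<close> for each \<open>C\<close>: equality
    holds throughout. Invariance in \<open>C\<close> was shown only for \<open>q\<close>; for
    \<open>z\<close> it results here.\<close>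
  have "(\<Sum>C\<in>K. z C - q) = 0"
    using sum_z sum_q sum_nonneg[of K "\<lambda>C. z C - q"] q_le_z by (simp add: sum_subtractf)
  hence "\<forall>C\<in>K. z C = q"
    using finK q_le_z by (subst (asm) sum_nonneg_eq_0_iff) auto
  moreover have "B \<in> K" using Y by (auto simp: K_def n_def)
  ultimately have zB: "z B = q" and "real N = card K * q"
    using sum_z sum_q by auto
  moreover have "card K > 0" by (simp add: cK)
  ultimately show ?thesis
    by (simp add: z_def N_def cK m_def n_def field_simps)
qed

section \<open>Expected loss of profits\<close>

text \<open>The product is the expectation of \<open>(1 - Z) ^ k\<close> for \<open>m\<close> firms
  and \<open>n\<close> workers. Raising \<open>m\<close> by one changes the sum by a telescoping one
  that is at most \<open>1 / (n - m)\<close>, the new harmonic term. The summand for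
  \<open>k = 0\<close> vanishes since division by 0 gives 0.\<close>

lemma rising_ratio_sum_le:
  assumes "m \<le> n"
  shows "(\<Sum>k<K. (\<Prod>i<k. real (m + i) / real (n + 1 + i)) / real k) \<le> (\<Sum>i\<in>{n - m<..n}. 1 / real i)"
  using assms
proof (induction m)
  case 0
  have "(\<Prod>i<k. real (0 + i) / real (n + 1 + i)) / real k = 0" for k
    by (cases "k = 0") (auto simp: prod_zero_iff)
  hence "(\<Sum>k<K. (\<Prod>i<k. real (0 + i) / real (n + 1 + i)) / real k) = 0"
    by (intro sum.neutral ballI)
  thus ?case by simp
next
  case (Suc m)
  define r where "r m k = (\<Prod>i<k. real (m + i) / real (n + 1 + i))" for m k
  \<comment> \<open>Both numerators contain \<open>P\<close>; their difference is
    \<open>P * (k + 1)\<close>, and the factor \<open>k + 1\<close> cancels the divisor.\<close>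
  have step: "r (Suc m) (Suc k) / real (Suc k) - r m (Suc k) / real (Suc k) = r (Suc m) k / real (n + 1 + k)" for k
  proof -
    define P Q where "P = (\<Prod>i<k. real (Suc m + i))" and "Q = (\<Prod>i<k. real (n + 1 + i))"
    have Q: "Q > 0" unfolding Q_def by (intro prod_pos) auto
    have "(\<Prod>i<Suc k. real (m + i)) = real m * P"
      unfolding P_def by (subst prod.lessThan_Suc_shift) simp
    moreover have "(\<Prod>i<Suc k. real (Suc m + i)) = P * real (Suc m + k)"
      by (simp add: P_def)
    ultimately have "r (Suc m) (Suc k) - r m (Suc k) = (P * real (Suc k)) / (Q * real (n + 1 + k))"
      unfolding r_def prod_dividef by (simp add: Q_def algebra_simps flip: diff_divide_distrib)
    hence "(r (Suc m) (Suc k) - r m (Suc k)) / real (Suc k) = P / Q / real (n + 1 + k)"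
      using Q by (simp del: of_nat_Suc)
    thus ?thesis by (simp add: r_def P_def Q_def prod_dividef diff_divide_distrib)
  qed
  \<comment> \<open>Each summand equals
    \<open>(r (Suc m) k - r (Suc m) (Suc k)) / (n - m)\<close>.\<close>
  have tele: "(\<Sum>k<K. r (Suc m) k / real (n + 1 + k)) = (1 - r (Suc m) K) / real (n - m)" for K
  proof (induction K)
    case (Suc K)
    have "r (Suc m) (Suc K) = r (Suc m) K * (real (Suc m + K) / real (n + 1 + K))"
      by (simp add: r_def)
    moreover have "r (Suc m) K / real (n + 1 + K)
        = (r (Suc m) K - r (Suc m) K * (real (Suc m + K) / real (n + 1 + K))) / real (n - m)"
    proof -
      have "x / b = (x - x * ((b - d) / b)) / d" if "b > 0" "d > 0" for x b d :: real
        using that by (simp add: field_simps)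
      from this[of "real (n + 1 + K)" "real (n - m)" "r (Suc m) K"] show ?thesis
        using \<open>Suc m \<le> n\<close> by (simp add: of_nat_diff)
    qed
    ultimately show ?case using Suc by (simp add: diff_divide_distrib)
  qed (simp add: r_def)
  have "(\<Sum>k<K. r (Suc m) k / real k) - (\<Sum>k<K. r m k / real k) \<le> 1 / real (n - m)"
  proof (cases K)
    case (Suc L)
    have "(\<Sum>k<K. r (Suc m) k / real k) - (\<Sum>k<K. r m k / real k)
        = (\<Sum>k<L. r (Suc m) (Suc k) / real (Suc k) - r m (Suc k) / real (Suc k))"
      unfolding Suc by (subst (1 2) sum.lessThan_Suc_shift) (simp add: sum_subtractf)
    also have "\<dots> = (1 - r (Suc m) L) / real (n - m)"
      by (simp only: step tele)
    also have "\<dots> \<le> 1 / real (n - m)"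
      by (intro divide_right_mono) (auto simp: r_def intro!: prod_nonneg)
    finally show ?thesis .
  qed simp
  moreover have "{n - Suc m<..n} = insert (n - m) {n - m<..n}"
    using Suc.prems by auto
  ultimately show ?case
    using Suc by (simp add: r_def)
qed

text \<open>These are the Beta integrals for the parameters \<open>a + 1\<close> and
  \<open>p + 1\<close>. The recursion from splitting off one factor \<open>1 - Z\<close> determines
  them from the plain moments, without identifying the distribution of \<open>Z\<close>.\<close>

lemma (in prob_space) mixed_moments:
  fixes Z :: "'a \<Rightarrow> real"
  assumes [measurable]: "Z \<in> borel_measurable M" and bounded: "AE x in M. 0 \<le> Z x \<and> Z x \<le> 1"
    and moments: "\<And>j. expectation (\<lambda>x. Z x ^ j) = real ((a + j) choose a) / real ((a + Suc p + j) choose (a + Suc p))"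
  shows "expectation (\<lambda>x. Z x ^ j * (1 - Z x) ^ k)
    = fact (a + Suc p) / (fact a * fact p) * (fact (a + j) * fact (p + k) / fact (a + Suc p + j + k))"
proof (induction k arbitrary: j)
  case 0
  define N where "N = a + Suc p"
  have "real ((a + j) choose a) = fact (a + j) / (fact a * fact j)"
    "real ((N + j) choose N) = fact (N + j) / (fact N * fact j)"
    by (simp_all add: binomial_fact)
  thus ?case
    using moments[of j] unfolding N_def[symmetric] by simp
next
  case (Suc k)
  have integrable: "integrable M (\<lambda>x. Z x ^ j * (1 - Z x) ^ k)" for j
  proof (rule integrable_const_bound[where B = 1])
    show "AE x in M. norm (Z x ^ j * (1 - Z x) ^ k) \<le> 1"
      using bounded
    proof eventually_elim
      case (elim x)
      thus ?case by (auto simp: abs_mult power_abs intro!: mult_le_one power_le_one)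
    qed
  qed simp
  have "Z x ^ j * (1 - Z x) ^ Suc k = Z x ^ j * (1 - Z x) ^ k - Z x ^ Suc j * (1 - Z x) ^ k" for x
    by (simp add: algebra_simps)
  hence "expectation (\<lambda>x. Z x ^ j * (1 - Z x) ^ Suc k)
    = expectation (\<lambda>x. Z x ^ j * (1 - Z x) ^ k) - expectation (\<lambda>x. Z x ^ Suc j * (1 - Z x) ^ k)"
    using integrable by (subst Bochner_Integration.integral_diff[symmetric]) (auto simp del: power_Suc)
  also have "\<dots> = fact (a + Suc p) / (fact a * fact p) *
      (fact (a + j) * fact (p + k) / fact (a + Suc p + j + k)
       - fact (a + Suc j) * fact (p + k) / fact (a + Suc p + Suc j + k))"
    unfolding Suc.IH right_diff_distrib ..
  also have "fact (a + j) * fact (p + k) / fact (a + Suc p + j + k)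
       - fact (a + Suc j) * fact (p + k) / fact (a + Suc p + Suc j + k)
     = (fact (a + j) * fact (p + Suc k) / fact (a + Suc p + j + Suc k) :: real)"
  proof -
    have "fact (a + Suc p + Suc j + k) = real (a + Suc p + j + k + 1) * fact (a + Suc p + j + k)"
      "fact (a + Suc p + j + Suc k) = real (a + Suc p + j + k + 1) * fact (a + Suc p + j + k)"
      "fact (a + Suc j) = real (a + j + 1) * fact (a + j)"
      "fact (p + Suc k) = real (p + k + 1) * fact (p + k)"
      by (simp_all add: algebra_simps)
    thus ?thesis by (simp add: divide_simps) (simp add: algebra_simps)
  qed
  finally show ?case .
qed

lemma fact_ratio_eq_prod:
  "fact n / fact p * (fact (p + k) / fact (n + k)) = (\<Prod>i<k. real (Suc p + i) / real (n + 1 + i))"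
proof (induction k)
  case (Suc k)
  have "fact n / fact p * (fact (p + Suc k) / fact (n + Suc k))
     = fact n / fact p * (fact (p + k) / fact (n + k)) * (real (Suc p + k) / real (n + 1 + k))"
    by (simp add: field_simps)
  thus ?case by (simp only: Suc prod.lessThan_Suc)
qed simp

text \<open>The loss is at most \<open>- ln Z\<close>, which is expanded into the series of
  \<open>(1 - Z) ^ k / k\<close>. All terms are nonnegative, so the series is integrated termwise in
  the extended reals, and integrability of \<open>ln Z\<close> never has to be established
  first.\<close>

lemma expectation_sum_one_minus_marginal:
  assumes fin: "finite A" "finite B" and card: "card A \<le> card B"
  shows "iid_prob.expectation (\<lambda>\<omega>. \<Sum>f\<in>A. 1 - marginal \<omega> A B f)
    \<le> (\<Sum>i\<in>{card B - card A<..card B}. 1 / real i)"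
proof (cases "A = {}")
  case False
  define n p where "n = card B" and "p = card A - 1"
  define a where "a = n - card A"
  have m: "card A = Suc p" "n = a + Suc p"
    using False fin card by (auto simp: p_def a_def n_def card_gt_0_iff Suc_diff_1)
  define Z where "Z \<omega> = (\<Prod>f\<in>A. marginal \<omega> A B f)" for \<omega>
  have [measurable]: "Z \<in> borel_measurable iid"
    unfolding Z_def using fin by measurable
  have Z: "AE \<omega> in iid. 0 < Z \<omega> \<and> Z \<omega> \<le> 1"
    using AE_marginal[OF fin card]
  proof eventually_elim
    case (elim \<omega>)
    have "0 < Z \<omega>" unfolding Z_def by (rule prod_pos) (use elim in auto)
    moreover have "Z \<omega> \<le> 1"
      unfolding Z_def by (rule prod_le_1) (use elim in \<open>auto intro: less_imp_le\<close>)
    ultimately show ?case by simp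
  qed
  have Z': "AE \<omega> in iid. 0 \<le> Z \<omega> \<and> Z \<omega> \<le> 1" using Z by eventually_elim auto
  have moments: "iid_prob.expectation (\<lambda>\<omega>. Z \<omega> ^ j)
      = real ((a + j) choose a) / real ((a + Suc p + j) choose (a + Suc p))" for j
    using moment_marginals[OF fin card, of j] m by (simp add: Z_def n_def)
  have powers: "iid_prob.expectation (\<lambda>\<omega>. (1 - Z \<omega>) ^ k)
      = (\<Prod>i<k. real (card A + i) / real (n + 1 + i))" for k
  proof -
    have "iid_prob.expectation (\<lambda>\<omega>. (1 - Z \<omega>) ^ k) = fact n / fact p * (fact (p + k) / fact (n + k))"
      using iid_prob.mixed_moments[OF \<open>Z \<in> borel_measurable iid\<close> Z' moments, of 0 k]
      by (simp add: m add_ac)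
    thus ?thesis unfolding fact_ratio_eq_prod by (simp add: m)
  qed
  let ?h = "\<Sum>i\<in>{n - card A<..n}. 1 / real i"
  have "(\<integral>\<^sup>+\<omega>. ennreal (\<Sum>f\<in>A. 1 - marginal \<omega> A B f) \<partial>iid)
      \<le> (\<integral>\<^sup>+\<omega>. (\<Sum>k. ennreal ((1 - Z \<omega>) ^ k / real k)) \<partial>iid)"
    using AE_marginal[OF fin card] Z
  proof (intro nn_integral_mono_AE, eventually_elim)
    case (elim \<omega>)
    have "(\<Sum>f\<in>A. 1 - marginal \<omega> A B f) \<le> (\<Sum>f\<in>A. - ln (marginal \<omega> A B f))"
    proof (rule sum_mono)
      fix f assume "f \<in> A"
      with elim have "0 < marginal \<omega> A B f" by blast
      from ln_le_minus_one[OF this] show "1 - marginal \<omega> A B f \<le> - ln (marginal \<omega> A B f)" by simp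
    qed
    also have "\<dots> = - ln (Z \<omega>)"
      unfolding Z_def using fin elim by (subst ln_prod) (auto simp: sum_negf)
    finally have le: "(\<Sum>f\<in>A. 1 - marginal \<omega> A B f) \<le> - ln (Z \<omega>)" .
    \<comment> \<open>The series may start at 0, because its first term is a division by 0 and hence
      0.\<close>
    have "(\<lambda>k. - ((1 - Z \<omega>) ^ k / real k)) sums ln (Z \<omega>)"
      using ln_series'[of "Z \<omega> - 1"] elim by simp
    hence "(\<lambda>k. (1 - Z \<omega>) ^ k / real k) sums (- ln (Z \<omega>))"
      using sums_minus by fastforce
    hence "(\<Sum>k. ennreal ((1 - Z \<omega>) ^ k / real k)) = ennreal (- ln (Z \<omega>))"
      using elim by (intro suminf_ennreal_eq) auto
    thus ?case using le by (simp add: ennreal_leI)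
  qed
  also have "\<dots> = (\<Sum>k. \<integral>\<^sup>+\<omega>. ennreal ((1 - Z \<omega>) ^ k / real k) \<partial>iid)"
    by (rule nn_integral_suminf) simp
  also have "\<dots> = (\<Sum>k. ennreal ((\<Prod>i<k. real (card A + i) / real (n + 1 + i)) / real k))"
  proof (intro arg_cong[where f = suminf] ext)
    fix k
    have nonneg: "AE \<omega> in iid. 0 \<le> (1 - Z \<omega>) ^ k / real k"
      using Z by eventually_elim auto
    have "integrable iid (\<lambda>\<omega>. (1 - Z \<omega>) ^ k / real k)"
    proof (rule iid_prob.integrable_const_bound[where B = 1])
      show "AE \<omega> in iid. norm ((1 - Z \<omega>) ^ k / real k) \<le> 1"
        using Z
      proof eventually_elim
        case (elim \<omega>)
        have "(1 - Z \<omega>) ^ k \<le> 1" using elim by (intro power_le_one) auto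
        thus ?case using elim by (cases "k = 0") (auto simp: divide_simps)
      qed
    qed simp
    hence "(\<integral>\<^sup>+\<omega>. ennreal ((1 - Z \<omega>) ^ k / real k) \<partial>iid)
        = ennreal (iid_prob.expectation (\<lambda>\<omega>. (1 - Z \<omega>) ^ k / real k))"
      by (rule nn_integral_eq_integral[OF _ nonneg])
    thus "(\<integral>\<^sup>+\<omega>. ennreal ((1 - Z \<omega>) ^ k / real k) \<partial>iid)
        = ennreal ((\<Prod>i<k. real (card A + i) / real (n + 1 + i)) / real k)"
      using powers[of k] by simp
  qed
  also have "\<dots> \<le> ennreal ?h"
  proof (rule suminf_le_const[OF summableI])
    fix K
    show "(\<Sum>k<K. ennreal ((\<Prod>i<k. real (card A + i) / real (n + 1 + i)) / real k)) \<le> ennreal ?h"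
      using rising_ratio_sum_le[of "card A" n K] card
      by (subst sum_ennreal) (auto intro!: ennreal_leI divide_nonneg_nonneg prod_nonneg simp: n_def)
  qed
  finally have nn: "(\<integral>\<^sup>+\<omega>. ennreal (\<Sum>f\<in>A. 1 - marginal \<omega> A B f) \<partial>iid) \<le> ennreal ?h" .
  have nonneg: "AE \<omega> in iid. 0 \<le> (\<Sum>f\<in>A. 1 - marginal \<omega> A B f)"
    using AE_marginal[OF fin card] by eventually_elim (auto intro!: sum_nonneg)
  have "(\<lambda>\<omega>. \<Sum>f\<in>A. 1 - marginal \<omega> A B f) \<in> borel_measurable iid" using fin by measurable
  hence "iid_prob.expectation (\<lambda>\<omega>. \<Sum>f\<in>A. 1 - marginal \<omega> A B f)
      = enn2real (\<integral>\<^sup>+\<omega>. ennreal (\<Sum>f\<in>A. 1 - marginal \<omega> A B f) \<partial>iid)"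
    by (rule integral_eq_nn_integral[OF _ nonneg])
  also have "\<dots> \<le> ?h"
    using nn by (rule enn2real_leI[rotated]) (auto intro!: sum_nonneg)
  finally show ?thesis by (simp add: n_def)
qed simp

section \<open>Bounds for the expected total salary\<close>

lemma AE_opt_value:
  assumes "finite A" "finite B" "card A \<le> card B"
  shows "AE \<omega> in iid. 0 \<le> opt_value \<omega> A B \<and> opt_value \<omega> A B \<le> real (card A)"
  using AE_entries[OF assms(1,2)]
proof eventually_elim
  case (elim \<omega>)
  obtain \<sigma> where s: "inj_on \<sigma> A" "\<sigma> ` A \<subseteq> B" "opt_value \<omega> A B = (\<Sum>f\<in>A. \<omega> (f, \<sigma> f))"
    using opt_value_attained[OF assms] by metis
  have "0 \<le> \<omega> (f, \<sigma> f) \<and> \<omega> (f, \<sigma> f) \<le> 1" if "f \<in> A" for f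
    using elim s that by (auto intro!: less_imp_le)
  thus ?case
    unfolding s(3) using sum_bounded_above[of A "\<lambda>f. \<omega> (f, \<sigma> f)" 1] by (auto intro!: sum_nonneg)
qed

lemma integrable_opt_value:
  assumes "finite A" "finite B" "card A \<le> card B"
  shows "integrable iid (\<lambda>\<omega>. opt_value \<omega> A B)"
proof (rule iid_prob.integrable_const_bound[where B = "real (card A)"])
  show "AE \<omega> in iid. norm (opt_value \<omega> A B) \<le> real (card A)"
    using AE_opt_value[OF assms] by eventually_elim auto
qed (use assms in simp)

lemma integrable_marginal:
  assumes "finite A" "finite B" "card A \<le> card B"
  shows "integrable iid (\<lambda>\<omega>. marginal \<omega> A B f)"
proof -
  have "card (A - {f}) \<le> card B" using assms by (meson card_Diff1_le order_trans)
  thus ?thesis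
    unfolding marginal_def using assms
    by (intro Bochner_Integration.integrable_diff integrable_opt_value) auto
qed

text \<open>A single firm's marginal is the maximum of its row, so this is the first moment in
  \<open>moment_marginals\<close>.\<close>

lemma expectation_opt_value_singleton:
  assumes "finite B" "B \<noteq> {}"
  shows "iid_prob.expectation (\<lambda>\<omega>. opt_value \<omega> {f} B) = real (card B) / real (card B + 1)"
proof -
  have "card B > 0" using assms by (simp add: card_gt_0_iff)
  hence "card B choose (card B - 1) = card B"
    by (subst binomial_symmetric) auto
  thus ?thesis
    using moment_marginals[of "{f}" B 1] assms \<open>card B > 0\<close> by (simp add: marginal_def)
qed

lemma expectation_entry: "iid_prob.expectation (\<lambda>\<omega>. \<omega> (f, w)) = 1 / 2"
proof -
  have "opt_value \<omega> {f} {w} = \<omega> (f, w)" for \<omega> :: "'a \<times> nat \<Rightarrow> real"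
  proof -
    obtain \<sigma> where "\<sigma> ` {f} \<subseteq> {w}" "opt_value \<omega> {f} {w} = (\<Sum>g\<in>{f}. \<omega> (g, \<sigma> g))"
      by (rule opt_value_attained[of "{f}" "{w}" \<omega>]) auto
    thus ?thesis by simp
  qed
  thus ?thesis using expectation_opt_value_singleton[of "{w}" f] by simp
qed

text \<open>No firm gets more than its row maximum, whose mean falls short of 1 by
  \<open>1 / (n + 1)\<close>.\<close>

lemma expectation_opt_value_le:
  assumes "finite F" "finite W" "card F = card W"
  shows "iid_prob.expectation (\<lambda>\<omega>. opt_value \<omega> F W) \<le> real (card W) * real (card W) / real (card W + 1)"
proof (cases "W = {}")
  case False
  hence W: "1 \<le> card W" using assms by (simp add: Suc_leI card_gt_0_iff)
  have "opt_value \<omega> F W \<le> (\<Sum>f\<in>F. opt_value \<omega> {f} W)" for \<omega> :: "'a \<times> nat \<Rightarrow> real"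
  proof -
    obtain \<sigma> where s: "\<sigma> ` F \<subseteq> W" "opt_value \<omega> F W = (\<Sum>f\<in>F. \<omega> (f, \<sigma> f))"
      using opt_value_attained[OF assms(1,2)] assms(3) by (metis order_refl)
    have "\<omega> (f, \<sigma> f) \<le> opt_value \<omega> {f} W" if "f \<in> F" for f
      using opt_value_ge[of "{f}" W \<sigma> \<omega>] that s assms by auto
    thus ?thesis unfolding s by (rule sum_mono)
  qed
  hence "iid_prob.expectation (\<lambda>\<omega>. opt_value \<omega> F W)
      \<le> iid_prob.expectation (\<lambda>\<omega>. \<Sum>f\<in>F. opt_value \<omega> {f} W)"
    using assms W by (intro integral_mono Bochner_Integration.integrable_sum integrable_opt_value) auto
  also have "\<dots> = (\<Sum>f\<in>F. iid_prob.expectation (\<lambda>\<omega>. opt_value \<omega> {f} W))"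
    using assms W by (intro Bochner_Integration.integral_sum integrable_opt_value) auto
  finally show ?thesis
    using assms by (simp add: expectation_opt_value_singleton[OF assms(2) False])
qed (use assms in simp)

section \<open>Upper bound by the logarithm\<close>

lemma integrable_total_salary:
  assumes "finite F" "finite W" "card F = card W"
  shows "integrable iid (\<lambda>\<omega>. total_salary \<omega> F W)"
  unfolding total_salary_def using assms
  by (intro Bochner_Integration.integrable_diff Bochner_Integration.integrable_sum
      integrable_opt_value integrable_marginal) auto

lemma expectation_total_salary:
  assumes "finite F" "finite W" "card F = card W"
  shows "iid_prob.expectation (\<lambda>\<omega>. total_salary \<omega> F W)
    = iid_prob.expectation (\<lambda>\<omega>. \<Sum>f\<in>F. 1 - marginal \<omega> F W f)
      - (real (card F) - iid_prob.expectation (\<lambda>\<omega>. opt_value \<omega> F W))"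
proof -
  have "total_salary \<omega> F W = (\<Sum>f\<in>F. 1 - marginal \<omega> F W f) + (opt_value \<omega> F W - real (card F))"
    for \<omega> :: "'a \<times> nat \<Rightarrow> real"
    by (simp add: total_salary_def sum_subtractf)
  moreover have "integrable iid (\<lambda>\<omega>. \<Sum>f\<in>F. 1 - marginal \<omega> F W f)"
    using assms by (intro Bochner_Integration.integrable_sum Bochner_Integration.integrable_diff
        integrable_marginal) auto
  moreover have "integrable iid (\<lambda>\<omega>. opt_value \<omega> F W - real (card F))"
    using assms by (intro Bochner_Integration.integrable_diff integrable_opt_value) auto
  moreover have "integrable iid (\<lambda>\<omega>. opt_value \<omega> F W)"
    using assms by (intro integrable_opt_value) auto
  ultimately show ?thesis by simp
qed

text \<open>The right-hand side is twice the inverse hyperbolic tangent of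
  \<open>(x - 1) / (x + 1)\<close>, the left-hand side the first term of its series.\<close>

lemma ln_ge_rational:
  fixes x :: real
  assumes "1 \<le> x"
  shows "2 * (x - 1) / (x + 1) \<le> ln x"
proof -
  define g where "g t = ln t - 2 * (t - 1) / (t + 1)" for t :: real
  have "g 1 \<le> g x"
  proof (rule DERIV_nonneg_imp_nondecreasing[OF assms])
    fix t :: real assume t: "1 \<le> t" "t \<le> x"
    have "(g has_real_derivative (1 / t - 4 / (t + 1)\<^sup>2)) (at t)"
      unfolding g_def using t
      by (auto intro!: derivative_eq_intros simp: power2_eq_square)
    moreover have "1 / t - 4 / (t + 1)\<^sup>2 = (t - 1)\<^sup>2 / (t * (t + 1)\<^sup>2)"
      using t by (simp add: divide_simps) (simp add: power2_eq_square algebra_simps)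
    ultimately show "\<exists>y. (g has_real_derivative y) (at t) \<and> 0 \<le> y"
      using t by (intro exI[of _ "(t - 1)\<^sup>2 / (t * (t + 1)\<^sup>2)"]) auto
  qed
  thus ?thesis by (simp add: g_def)
qed

text \<open>The claim fails for 1 and 2. From \<open>n\<close> to \<open>n + 1\<close> the left-hand
  side grows by \<open>1 / (n + 2)\<close> and the logarithm by at least
  \<open>2 / (2 * n + 1)\<close>.\<close>

lemma harmonic_minus_le_ln:
  assumes "3 \<le> n"
  shows "(\<Sum>i\<in>{0<..n}. 1 / real i) - real n / real (n + 1) \<le> ln (real n)"
  using assms
proof (induction n rule: dec_induct)
  case base
  \<comment> \<open>The claim is \<open>13 / 12 \<le> ln 3\<close>. Applied to 3 directly,
    \<open>ln_ge_rational\<close> gives only 1; the factors 3/2, 3/2 and 4/3 give 38/35, which is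
    enough.\<close>
  have "ln (3 / 2 * (4 / 3)) = ln (3 / 2 :: real) + ln (4 / 3)"
    "ln (3 / 2 * (3 / 2 * (4 / 3))) = ln (3 / 2 :: real) + ln (3 / 2 * (4 / 3))"
    by (subst ln_mult; simp)+
  moreover have "2 / 5 \<le> ln (3 / 2 :: real)" "2 / 7 \<le> ln (4 / 3 :: real)"
    using ln_ge_rational[of "3 / 2"] ln_ge_rational[of "4 / 3"] by simp_all
  moreover have "{0<..3} = {1, 2, 3 :: nat}" by auto
  ultimately show ?case by simp
next
  case (step n)
  have "2 * ((real n + 1) / real n - 1) / ((real n + 1) / real n + 1) \<le> ln ((real n + 1) / real n)"
    using step by (intro ln_ge_rational) simp
  moreover have "2 * ((real n + 1) / real n - 1) / ((real n + 1) / real n + 1) = 2 / (2 * real n + 1)"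
    using step by (simp add: field_simps)
  moreover have "1 / real (n + 2) \<le> 2 / (2 * real n + 1)"
    by (simp add: divide_simps)
  moreover have "ln ((real n + 1) / real n) = ln (real (Suc n)) - ln (real n)"
    using step by (subst ln_div) (auto simp: add_ac)
  moreover have "1 / real (Suc n) - real (Suc n) / real (Suc n + 1) + real n / real (n + 1) = 1 / real (n + 2)"
    by (simp add: divide_simps) (simp add: algebra_simps)
  moreover have "{0<..Suc n} = insert (Suc n) {0<..n}" by auto
  ultimately show ?case using step by simp
qed

lemma expectation_total_salary_le_ln:
  assumes fin: "finite F" "finite W" and card: "card F = n" "card W = n" and n: "1 \<le> n"
  shows "iid_prob.expectation (\<lambda>\<omega>. total_salary \<omega> F W) \<le> ln (real n)"
proof -
  have FW: "card F = card W" "card F \<le> card W" using card by auto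
  consider "n = 1" | "n = 2" | "3 \<le> n" using n by linarith
  thus ?thesis
  proof cases
    case 1
    then obtain f where F: "F = {f}" using card by (auto simp: card_1_singleton_iff)
    have "total_salary \<omega> F W = 0" for \<omega> :: "'a \<times> nat \<Rightarrow> real"
      by (simp add: total_salary_def marginal_def F)
    thus ?thesis using 1 by simp
  next
    \<comment> \<open>The general bound would be 5/6, above \<open>ln 2\<close>. Here the total
      salary is the sum of the row maxima minus the optimum, and bounding the optimum below by one
      fixed matching gives 1/3.\<close>
    case 2
    obtain f g where F: "F = {f, g}" "f \<noteq> g" using card 2 by (auto simp: card_2_iff)
    obtain a b where W: "W = {a, b}" "a \<noteq> b" using card 2 by (auto simp: card_2_iff)
    have le: "total_salary \<omega> F W \<le> opt_value \<omega> {f} W + opt_value \<omega> {g} W - (\<omega> (f, a) + \<omega> (g, b))"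
      for \<omega> :: "'a \<times> nat \<Rightarrow> real"
    proof -
      have "(\<Sum>h\<in>F. \<omega> (h, if h = f then a else b)) \<le> opt_value \<omega> F W"
        using fin F W by (intro opt_value_ge) (auto simp: inj_on_def)
      moreover have "F - {f} = {g}" "F - {g} = {f}" using F by auto
      ultimately show ?thesis using F by (simp add: total_salary_def marginal_def)
    qed
    \<comment> \<open>A function that is not integrable has integral 0 by convention, but this
      expectation is 1/2.\<close>
    have int_e: "integrable iid (\<lambda>\<omega>. \<omega> p)" for p :: "'a \<times> nat"
    proof (rule ccontr)
      obtain h w where p: "p = (h, w)" by fastforce
      assume "\<not> integrable iid (\<lambda>\<omega>. \<omega> p)"
      hence "iid_prob.expectation (\<lambda>\<omega>. \<omega> p) = 0" by (rule not_integrable_integral_eq)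
      thus False using expectation_entry[of h w] p by simp
    qed
    have int_o: "integrable iid (\<lambda>\<omega>. opt_value \<omega> {h} W)" for h :: 'a
      using fin card 2 by (intro integrable_opt_value) auto
    have "iid_prob.expectation (\<lambda>\<omega>. total_salary \<omega> F W)
      \<le> iid_prob.expectation (\<lambda>\<omega>. opt_value \<omega> {f} W + opt_value \<omega> {g} W - (\<omega> (f, a) + \<omega> (g, b)))"
      using fin FW int_e int_o le
      by (intro integral_mono integrable_total_salary Bochner_Integration.integrable_diff
          Bochner_Integration.integrable_add) auto
    also have "\<dots> = 2 / 3 + 2 / 3 - (1 / 2 + 1 / 2)"
      using int_e int_o fin card 2 W
      by (simp add: expectation_opt_value_singleton expectation_entry)
    also have "\<dots> \<le> ln 2" using ln_ge_rational[of 2] by simp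
    finally show ?thesis using 2 by simp
  next
    case 3
    have "iid_prob.expectation (\<lambda>\<omega>. total_salary \<omega> F W)
       \<le> (\<Sum>i\<in>{0<..n}. 1 / real i) - (real n - real n * real n / real (n + 1))"
      unfolding expectation_total_salary[OF fin FW(1)]
      using expectation_sum_one_minus_marginal[OF fin FW(2)] expectation_opt_value_le[OF fin FW(1)] card
      by simp
    also have "real n - real n * real n / real (n + 1) = real n / real (n + 1)"
      by (simp add: field_simps)
    finally show ?thesis using harmonic_minus_le_ln[OF 3] by simp
  qed
qed

section \<open>Lower bound of logarithmic order\<close>

text \<open>Let \<open>a A\<close> be the expected deficit of \<open>A\<close>. The expectation of
  \<open>1 - marginal\<close> at \<open>f\<close> is \<open>a A - a (A - {f})\<close>; summing over
  the m firms of \<open>A\<close> bounds m times \<open>a A\<close>, minus the deficits of the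
  smaller markets, by a harmonic difference. Induction on m then adds these differences divided by
  m.\<close>

lemma expectation_opt_value_deficit_le:
  assumes fin: "finite A" "finite B" and card: "card A \<le> card B"
  shows "real (card A) - iid_prob.expectation (\<lambda>\<omega>. opt_value \<omega> A B)
    \<le> (\<Sum>m\<in>{1..card A}. (\<Sum>i\<in>{card B - m<..card B}. 1 / real i) / real m)"
  using assms
proof (induction "card A" arbitrary: A)
  case 0
  thus ?case by simp
next
  case (Suc k)
  define n where "n = card B"
  define T where "T k = (\<Sum>m\<in>{1..k}. (\<Sum>i\<in>{n - m<..n}. 1 / real i) / real m)" for k
  define a where "a A = real (card A) - iid_prob.expectation (\<lambda>\<omega>. opt_value \<omega> A B)" for A :: "'a set"
  have A: "finite A" "card A = Suc k" "Suc k \<le> n"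
    using Suc.prems Suc.hyps(2) by (auto simp: n_def)
  have B: "finite B" "card A \<le> card B" using Suc.prems by auto
  have IH: "a (A - {f}) \<le> T k" if "f \<in> A" for f
  proof -
    have "card (A - {f}) = k" using A that by simp
    thus ?thesis using Suc.hyps(1)[of "A - {f}"] A B by (simp add: a_def T_def n_def)
  qed
  have marg: "iid_prob.expectation (\<lambda>\<omega>. 1 - marginal \<omega> A B f) = a A - a (A - {f})" if "f \<in> A" for f
  proof -
    have "iid_prob.expectation (\<lambda>\<omega>. marginal \<omega> A B f)
       = iid_prob.expectation (\<lambda>\<omega>. opt_value \<omega> A B) - iid_prob.expectation (\<lambda>\<omega>. opt_value \<omega> (A - {f}) B)"
      unfolding marginal_def using A B that
      by (intro Bochner_Integration.integral_diff integrable_opt_value) auto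
    moreover have "integrable iid (\<lambda>\<omega>. marginal \<omega> A B f)"
      using A B by (intro integrable_marginal) auto
    ultimately show ?thesis
      using A that by (simp add: a_def)
  qed
  have "(\<Sum>f\<in>A. a A - a (A - {f})) = (\<Sum>f\<in>A. iid_prob.expectation (\<lambda>\<omega>. 1 - marginal \<omega> A B f))"
    by (intro sum.cong refl) (simp add: marg)
  also have "\<dots> = iid_prob.expectation (\<lambda>\<omega>. \<Sum>f\<in>A. 1 - marginal \<omega> A B f)"
    using A B by (intro Bochner_Integration.integral_sum[symmetric]
        Bochner_Integration.integrable_diff integrable_marginal) auto
  also have "\<dots> \<le> (\<Sum>i\<in>{n - Suc k<..n}. 1 / real i)"
    using expectation_sum_one_minus_marginal[of A B] A B by (simp add: n_def)
  finally have "real (Suc k) * a A - (\<Sum>f\<in>A. a (A - {f})) \<le> (\<Sum>i\<in>{n - Suc k<..n}. 1 / real i)"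
    using A by (simp add: sum_subtractf)
  moreover have "(\<Sum>f\<in>A. a (A - {f})) \<le> real (Suc k) * T k"
    using sum_bounded_above[of A "\<lambda>f. a (A - {f})" "T k"] IH A by simp
  ultimately have "real (Suc k) * (a A - T k) \<le> (\<Sum>i\<in>{n - Suc k<..n}. 1 / real i)"
    unfolding right_diff_distrib by linarith
  hence "a A - T k \<le> (\<Sum>i\<in>{n - Suc k<..n}. 1 / real i) / real (Suc k)"
    by (subst pos_le_divide_eq) (simp_all only: mult.commute of_nat_0_less_iff zero_less_Suc)
  hence "a A \<le> T k + (\<Sum>i\<in>{n - Suc k<..n}. 1 / real i) / real (Suc k)" by linarith
  also have "\<dots> = T (Suc k)" by (simp add: T_def)
  finally show ?case using A by (simp add: a_def T_def n_def)
qed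

text \<open>On the region \<open>m + i > n\<close> one has 1 / (i m) = (1 / m + 1 / i) / (m + i),
  which is at most (1 / m + 1 / i) / n. For fixed m there are m values of i, so the terms 1 / m add
  up to n; by symmetry of the region so do the terms 1 / i.\<close>

lemma double_harmonic_le_2:
  "(\<Sum>m\<in>{1..n}. (\<Sum>i\<in>{n - m<..n}. 1 / real i) / real m) \<le> 2"
proof (cases "n = 0")
  case False
  have one: "(\<Sum>m\<in>{1..n}. \<Sum>i\<in>{n - m<..n}. 1 / real m) = real n"
  proof -
    have "(\<Sum>m\<in>{1..n}. \<Sum>i\<in>{n - m<..n}. 1 / real m) = (\<Sum>m\<in>{1..n}. 1 :: real)"
      by (intro sum.cong) auto
    thus ?thesis by simp
  qed
  have "(\<Sum>m\<in>{1..n}. (\<Sum>i\<in>{n - m<..n}. 1 / real i) / real m)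
      \<le> (\<Sum>m\<in>{1..n}. \<Sum>i\<in>{n - m<..n}. (1 / real m + 1 / real i) / real n)"
    unfolding sum_divide_distrib
  proof (intro sum_mono)
    fix m i assume m: "m \<in> {1..n}" and i: "i \<in> {n - m<..n}"
    hence pos: "0 < real m" "0 < real i" "real n \<le> real m + real i" by auto
    have "1 / y / x = (1 / x + 1 / y) / (x + y)" if "0 < x" "0 < y" for x y :: real
    proof -
      have "1 / x + 1 / y = (x + y) * (1 / y / x)" using that by (simp add: field_simps)
      thus ?thesis using that by simp
    qed
    hence "1 / real i / real m = (1 / real m + 1 / real i) / (real m + real i)"
      using pos by blast
    also have "\<dots> \<le> (1 / real m + 1 / real i) / real n"
      using pos False by (intro divide_left_mono) auto
    finally show "1 / real i / real m \<le> (1 / real m + 1 / real i) / real n" .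
  qed
  also have "\<dots> = ((\<Sum>m\<in>{1..n}. \<Sum>i\<in>{n - m<..n}. 1 / real m) + (\<Sum>m\<in>{1..n}. \<Sum>i\<in>{n - m<..n}. 1 / real i)) / real n"
    by (simp only: sum.distrib sum_divide_distrib[symmetric])
  also have "(\<Sum>m\<in>{1..n}. \<Sum>i\<in>{n - m<..n}. 1 / real i) = (\<Sum>m\<in>{1..n}. \<Sum>i\<in>{i \<in> {1..n}. n < m + i}. 1 / real i)"
    by (intro sum.cong) auto
  also have "\<dots> = (\<Sum>i\<in>{1..n}. \<Sum>m\<in>{m \<in> {1..n}. n < m + i}. 1 / real i)"
    by (rule sum.swap_restrict) auto
  also have "\<dots> = (\<Sum>i\<in>{1..n}. \<Sum>m\<in>{n - i<..n}. 1 / real i)"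
    by (intro sum.cong) auto
  finally show ?thesis using False unfolding one by simp
qed simp

lemma prob_row_less:
  assumes "finite T" "0 \<le> t" "t \<le> 1"
  shows "iid_prob.prob {\<omega>. \<forall>w\<in>T. \<omega> (f, w) < t} = t ^ card T"
proof -
  have "{\<omega> :: 'a \<times> nat \<Rightarrow> real. \<forall>w\<in>T. \<omega> (f, w) < t}
      = prod_emb UNIV (\<lambda>_. unif) (Pair f ` T) (Pi\<^sub>E (Pair f ` T) (\<lambda>_. {..<t}))"
    by (auto simp: prod_emb_def PiE_iff)
  hence "iid_prob.prob {\<omega>. \<forall>w\<in>T. \<omega> (f, w) < t} = (\<Prod>p\<in>Pair f ` T. measure unif {..<t})"
    unfolding iid_def using assms by (simp only:) (subst iid.measure_PiM_emb, auto)
  also have "\<dots> = t ^ card T"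
    using assms by (simp add: card_image inj_on_def measure_def emeasure_unif_lessThan)
  finally show ?thesis .
qed

lemma expectation_prod_marginals:
  assumes "finite F" "finite W" "card F = card W"
  shows "iid_prob.expectation (\<lambda>\<omega>. \<Prod>f\<in>F. marginal \<omega> F W f) = 1 / real (card W + 1)"
  using moment_marginals[of F W 1] assms by simp

text \<open>The three subtracted terms in the bracket bound the failure probabilities of the events
  that \<open>Z\<close> is below \<open>1 / sqrt n\<close>, that the total salary is below
  \<open>n / 256\<close>, and that no row has half of its entries below 1/64. The final 2 bounds the
  loss of the optimal matching.\<close>

lemma expectation_total_salary_ge:
  assumes fin: "finite F" "finite W" and card: "card F = n" "card W = n" and n: "1 \<le> n"
  shows "ln (real n) / 256 * (1 - sqrt (real n) / real (n + 1) - 256 * ln (real n) / real n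
      - real n * (1 / 4) ^ n) - 2
    \<le> iid_prob.expectation (\<lambda>\<omega>. total_salary \<omega> F W)"
proof -
  have FW: "card F = card W" "card F \<le> card W" using card by auto
  define Ts where "Ts = {T. T \<subseteq> W \<and> n \<le> 2 * card T}"
  \<comment> \<open>The threshold is twice 1/128, the lower bound aimed at for profits. A set of at
    least n / 2 workers then has probability at most \<open>(1 / 8) ^ n\<close>, which beats the
    \<open>2 ^ n\<close> possible sets.\<close>
  define Row where "Row f T = {\<omega> :: 'a \<times> nat \<Rightarrow> real. \<forall>w\<in>T. \<omega> (f, w) < 1 / 64}" for f T
  define Z where "Z \<omega> = (\<Prod>f\<in>F. marginal \<omega> F W f)" for \<omega>
  define S where "S \<omega> = total_salary \<omega> F W" for \<omega> :: "'a \<times> nat \<Rightarrow> real"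
  define D where "D \<omega> = (\<Sum>f\<in>F. 1 - marginal \<omega> F W f)" for \<omega> :: "'a \<times> nat \<Rightarrow> real"
  \<comment> \<open>\<open>- ln Z\<close> exceeds \<open>ln n / 2\<close>, and passing from
    \<open>- ln x\<close> to \<open>1 - x\<close> costs a factor of 128.\<close>
  define L where "L = ln (real n) / 256"
  have L: "0 \<le> L" using n by (simp add: L_def)
  have Ts: "finite Ts" "card Ts \<le> 2 ^ n" and Ts_fin: "\<And>T. T \<in> Ts \<Longrightarrow> finite T"
  proof -
    have "Ts \<subseteq> Pow W" by (auto simp: Ts_def)
    thus "finite Ts" "card Ts \<le> 2 ^ n"
      using fin card card_mono[of "Pow W" Ts] by (auto simp: card_Pow finite_subset)
    show "\<And>T. T \<in> Ts \<Longrightarrow> finite T" using fin by (auto simp: Ts_def finite_subset)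
  qed
  have Row_meas: "Row f T \<in> sets iid" if "T \<in> Ts" for f T
  proof -
    have "{\<omega> \<in> space iid. \<forall>w\<in>T. \<omega> (f, w) < 1 / 64} \<in> sets (iid :: ('a \<times> nat \<Rightarrow> real) measure)"
      using Ts_fin[OF that] by (intro sets.sets_Collect_finite_All borel_measurable_less) auto
    thus ?thesis by (simp add: Row_def)
  qed
  have Row_prob: "iid_prob.prob (Row f T) \<le> (1 / 8) ^ n" if "T \<in> Ts" for f T
  proof -
    have "iid_prob.prob (Row f T) = (1 / 64) ^ card T"
      unfolding Row_def using Ts_fin[OF that] by (intro prob_row_less) auto
    also have "\<dots> = (1 / 8 :: real) ^ (2 * card T)"
      by (simp add: power_mult power2_eq_square)
    also have "\<dots> \<le> (1 / 8) ^ n" using that by (intro power_decreasing) (auto simp: Ts_def)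
    finally show ?thesis .
  qed
  \<comment> \<open>Markov's inequality for all three failures at once: if one error term reaches 1,
    the left-hand side is nonpositive; otherwise nothing fails and
    \<open>L \<le> D \<omega>\<close>.\<close>
  have pointwise: "AE \<omega> in iid. L * (1 - sqrt (real n) * Z \<omega> - 256 * S \<omega> / real n
      - (\<Sum>f\<in>F. \<Sum>T\<in>Ts. indicator (Row f T) \<omega>)) \<le> D \<omega>"
    using AE_marginal[OF fin FW(2)] AE_entries[OF fin]
  proof eventually_elim
    case (elim \<omega>)
    have u: "0 < marginal \<omega> F W f" "marginal \<omega> F W f \<le> 1" if "f \<in> F" for f
      using elim that by auto
    have nonneg: "0 \<le> \<omega> (f, w)" if "f \<in> F" "w \<in> W" for f w
      using elim that by (auto intro: less_imp_le)
    have Z: "0 < Z \<omega>" unfolding Z_def using u by (intro prod_pos) auto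
    have S: "0 \<le> S \<omega>" unfolding S_def using fin FW nonneg by (intro total_salary_nonneg) auto
    have D: "0 \<le> D \<omega>" unfolding D_def using u by (intro sum_nonneg) auto
    define I where "I = (\<Sum>f\<in>F. \<Sum>T\<in>Ts. indicator (Row f T) \<omega> :: real)"
    have I: "0 \<le> I" unfolding I_def by (intro sum_nonneg) auto
    have zS: "0 \<le> sqrt (real n) * Z \<omega>" "0 \<le> 256 * S \<omega> / real n" using Z S by auto
    show ?case
    proof (cases "1 \<le> sqrt (real n) * Z \<omega> \<or> 1 \<le> 256 * S \<omega> / real n \<or> 1 \<le> I")
      case True
      hence "1 - sqrt (real n) * Z \<omega> - 256 * S \<omega> / real n - I \<le> 0" using zS I by auto
      hence "L * (1 - sqrt (real n) * Z \<omega> - 256 * S \<omega> / real n - I) \<le> 0"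
        using L by (rule mult_nonneg_nonpos[rotated])
      thus ?thesis using D by (simp add: I_def)
    next
      case False
      hence small: "sqrt (real n) * Z \<omega> < 1" "256 * S \<omega> < real n" "I < 1" using n by auto
      \<comment> \<open>\<open>I\<close> counts the pairs of a firm and a set of workers whose
        \<open>Row\<close> event occurs, so \<open>I < 1\<close> excludes them all;
        \<open>256 * S \<omega> < n\<close> is the salary condition of
        \<open>row_small_if_marginal_small\<close> for 1/128.\<close>
      have u_ge: "1 / 128 \<le> marginal \<omega> F W f" if f: "f \<in> F" for f
      proof (rule ccontr)
        assume "\<not> ?thesis"
        then obtain T where T: "T \<subseteq> W" "card W \<le> 2 * card T" "\<And>w. w \<in> T \<Longrightarrow> \<omega> (f, w) < 2 * (1 / 128)"
          using row_small_if_marginal_small[where c = \<omega> and \<delta> = "1 / 128", OF fin FW(1) nonneg f]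
            small(2) card by (auto simp: S_def)
        hence "T \<in> Ts" "\<omega> \<in> Row f T" using card by (auto simp: Ts_def Row_def)
        hence "1 \<le> (\<Sum>T\<in>Ts. indicator (Row f T) \<omega> :: real)"
          using member_le_sum[of T Ts "\<lambda>T. indicator (Row f T) \<omega> :: real"] Ts by simp
        also have "\<dots> \<le> I"
          unfolding I_def using f fin
          by (intro member_le_sum[of f F "\<lambda>f. \<Sum>T\<in>Ts. indicator (Row f T) \<omega>"]) (auto intro!: sum_nonneg)
        finally show False using small(3) by simp
      qed
      have "ln (sqrt (real n) * Z \<omega>) < 0" using small(1) Z n by simp
      hence "ln (real n) / 2 \<le> - ln (Z \<omega>)" using Z n by (simp add: ln_mult ln_sqrt)
      also have "\<dots> = (\<Sum>f\<in>F. - ln (marginal \<omega> F W f))"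
        unfolding Z_def using fin u by (subst ln_prod) (auto simp: sum_negf dest!: u(1))
      also have "\<dots> \<le> (\<Sum>f\<in>F. 128 * (1 - marginal \<omega> F W f))"
      proof (rule sum_mono)
        fix f assume f: "f \<in> F"
        define x where "x = marginal \<omega> F W f"
        have x: "1 / 128 \<le> x" "x \<le> 1" using u u_ge f by (auto simp: x_def)
        have "- ln x = ln (1 / x)" using x by (simp add: ln_div)
        also have "\<dots> \<le> 1 / x - 1" using x by (intro ln_le_minus_one) auto
        also have "\<dots> = (1 - x) * (1 / x)" using x by (simp add: field_simps)
        also have "\<dots> \<le> (1 - x) * 128"
          using x by (intro mult_left_mono) (auto simp: field_simps)
        finally show "- ln (marginal \<omega> F W f) \<le> 128 * (1 - marginal \<omega> F W f)" by (simp add: x_def)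
      qed
      also have "\<dots> = 128 * D \<omega>" by (simp add: D_def sum_distrib_left)
      finally have "L \<le> D \<omega>" by (simp add: L_def)
      moreover have "L * (1 - sqrt (real n) * Z \<omega> - 256 * S \<omega> / real n - I) \<le> L * 1"
        using L zS I by (intro mult_left_mono) auto
      ultimately show ?thesis by (simp add: I_def)
    qed
  qed
  have int_ind: "integrable iid (indicat_real (Row f T))" if "T \<in> Ts" for f T
    using Row_meas[OF that] by (intro integrable_real_indicator) (auto simp: less_top[symmetric])
  have int_S: "integrable iid S"
    unfolding S_def using fin FW by (intro integrable_total_salary) auto
  have int_Z: "integrable iid Z"
  proof (rule iid_prob.integrable_const_bound[where B = 1])
    show "AE \<omega> in iid. norm (Z \<omega>) \<le> 1"
      using AE_marginal[OF fin FW(2)]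
    proof eventually_elim
      case (elim \<omega>)
      have "0 \<le> Z \<omega>" unfolding Z_def
        by (rule prod_nonneg) (use elim in \<open>auto intro: less_imp_le\<close>)
      moreover have "Z \<omega> \<le> 1" unfolding Z_def
        by (rule prod_le_1) (use elim in \<open>auto intro: less_imp_le\<close>)
      ultimately show ?case by simp
    qed
  qed (use fin in \<open>simp add: Z_def[abs_def]\<close>)
  have int_D: "integrable iid D"
    unfolding D_def using fin FW
    by (intro Bochner_Integration.integrable_sum Bochner_Integration.integrable_diff integrable_marginal) auto
  have int_I: "integrable iid (\<lambda>\<omega>. \<Sum>f\<in>F. \<Sum>T\<in>Ts. indicat_real (Row f T) \<omega>)"
    using int_ind by (intro Bochner_Integration.integrable_sum) auto
  have exp_I: "iid_prob.expectation (\<lambda>\<omega>. \<Sum>f\<in>F. \<Sum>T\<in>Ts. indicat_real (Row f T) \<omega>) \<le> real n * (1 / 4) ^ n"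
  proof -
    have "iid_prob.expectation (\<lambda>\<omega>. \<Sum>f\<in>F. \<Sum>T\<in>Ts. indicat_real (Row f T) \<omega>)
        = (\<Sum>f\<in>F. iid_prob.expectation (\<lambda>\<omega>. \<Sum>T\<in>Ts. indicat_real (Row f T) \<omega>))"
      using int_ind by (intro Bochner_Integration.integral_sum Bochner_Integration.integrable_sum) auto
    also have "\<dots> = (\<Sum>f\<in>F. \<Sum>T\<in>Ts. iid_prob.prob (Row f T))"
      using int_ind Row_meas by (intro sum.cong refl) (subst Bochner_Integration.integral_sum, auto)
    also have "\<dots> \<le> (\<Sum>f\<in>F. \<Sum>T\<in>Ts. (1 / 8) ^ n)"
      using Row_prob by (intro sum_mono) auto
    also have "\<dots> = real n * (real (card Ts) * (1 / 8) ^ n)" using card by simp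
    also have "\<dots> \<le> real n * (2 ^ n * (1 / 8) ^ n)"
      using Ts(2) by (intro mult_left_mono mult_right_mono) (auto simp flip: of_nat_le_iff)
    also have "2 ^ n * (1 / 8) ^ n = (1 / 4 :: real) ^ n" by (simp flip: power_mult_distrib)
    finally show ?thesis .
  qed
  have exp_Z: "iid_prob.expectation Z = 1 / real (n + 1)"
    using expectation_prod_marginals[OF fin FW(1)] card by (simp add: Z_def[abs_def])
  have exp_S: "iid_prob.expectation S \<le> ln (real n)"
    using expectation_total_salary_le_ln[OF fin card n] by (simp add: S_def[abs_def])
  have "L * (1 - sqrt (real n) / real (n + 1) - 256 * ln (real n) / real n - real n * (1 / 4) ^ n)
     \<le> L * (1 - sqrt (real n) * iid_prob.expectation Z - 256 * iid_prob.expectation S / real n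
      - iid_prob.expectation (\<lambda>\<omega>. \<Sum>f\<in>F. \<Sum>T\<in>Ts. indicat_real (Row f T) \<omega>))"
    using L exp_Z exp_I divide_right_mono[OF exp_S, of "real n / 256"]
    by (intro mult_left_mono) (auto simp: mult.commute)
  also have "\<dots> = iid_prob.expectation (\<lambda>\<omega>. L * (1 - sqrt (real n) * Z \<omega> - 256 * S \<omega> / real n
      - (\<Sum>f\<in>F. \<Sum>T\<in>Ts. indicator (Row f T) \<omega>)))"
    using int_Z int_S int_I by simp
  also have "\<dots> \<le> iid_prob.expectation D"
    using pointwise int_Z int_S int_I int_D by (intro integral_mono_AE) auto
  finally have "L * (1 - sqrt (real n) / real (n + 1) - 256 * ln (real n) / real n
      - real n * (1 / 4) ^ n) \<le> iid_prob.expectation D" .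
  moreover have "real n - iid_prob.expectation (\<lambda>\<omega>. opt_value \<omega> F W) \<le> 2"
    using expectation_opt_value_deficit_le[OF fin FW(2)] double_harmonic_le_2[of n] card by simp
  ultimately show ?thesis
    unfolding expectation_total_salary[OF fin FW(1)] card L_def D_def[abs_def] by linarith
qed

text \<open>Once the error terms are below 1/2, \<open>ln n / 512 - 2\<close> remains, and
  \<open>ln n \<ge> 2048\<close> lets half of the main term absorb the 2.\<close>

lemma eventually_lower_bound:
  "eventually (\<lambda>n. ln (real n) / 1024 \<le> ln (real n) / 256 * (1 - sqrt (real n) / real (n + 1)
     - 256 * ln (real n) / real n - real n * (1 / 4) ^ n) - 2) at_top"
proof -
  have "((\<lambda>n. sqrt (real n) / real (n + 1) + 256 * ln (real n) / real n + real n * (1 / 4) ^ n) \<longlongrightarrow> 0) at_top"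
    by real_asymp
  hence "eventually (\<lambda>n. sqrt (real n) / real (n + 1) + 256 * ln (real n) / real n
      + real n * (1 / 4) ^ n < 1 / 2) at_top"
    by (rule order_tendstoD) simp
  moreover have "eventually (\<lambda>n. 2048 \<le> ln (real n)) at_top"
    by real_asymp
  ultimately show ?thesis
  proof eventually_elim
    case (elim n)
    have "ln (real n) / 256 * (1 / 2) \<le> ln (real n) / 256 * (1 - sqrt (real n) / real (n + 1)
     - 256 * ln (real n) / real n - real n * (1 / 4) ^ n)"
      using elim by (intro mult_left_mono) auto
    thus ?case using elim(2) by linarith
  qed
qed

section \<open>Transfer from the canonical matrix to a given random market\<close>

lemma iid_uniform_matrix_distr:
  assumes "prob_space N" and iid_N: "iid_uniform_matrix N F W \<alpha>" and ne: "F \<times> W \<noteq> {}"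
  shows "(\<lambda>\<omega>. \<lambda>(f, w)\<in>F \<times> W. \<alpha> \<omega> f w) \<in> measurable N (PiM (F \<times> W) (\<lambda>_. unif))"
    and "distr N (PiM (F \<times> W) (\<lambda>_. unif)) (\<lambda>\<omega>. \<lambda>(f, w)\<in>F \<times> W. \<alpha> \<omega> f w) = PiM (F \<times> W) (\<lambda>_. unif)"
proof -
  interpret prob_space N by fact
  let ?X = "\<lambda>(f, w) \<omega>. \<alpha> \<omega> f w"
  have indep: "indep_vars (\<lambda>_. borel) ?X (F \<times> W)"
    and distr: "\<And>p. p \<in> F \<times> W \<Longrightarrow> distr N borel (?X p) = unif"
    using iid_N by (auto simp: iid_uniform_matrix_def unif_def)
  have rv: "\<And>p. p \<in> F \<times> W \<Longrightarrow> ?X p \<in> borel_measurable N"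
    using indep by (auto simp: indep_vars_def)
  have X_eq: "(\<lambda>\<omega>. \<lambda>(f, w)\<in>F \<times> W. \<alpha> \<omega> f w) = (\<lambda>\<omega>. \<lambda>p\<in>F \<times> W. ?X p \<omega>)"
    by (auto simp: fun_eq_iff)
  have sets: "sets (PiM (F \<times> W) (\<lambda>_. unif)) = sets (PiM (F \<times> W) (\<lambda>_. borel))"
    by (intro sets_PiM_cong) auto
  show "(\<lambda>\<omega>. \<lambda>(f, w)\<in>F \<times> W. \<alpha> \<omega> f w) \<in> measurable N (PiM (F \<times> W) (\<lambda>_. unif))"
    unfolding X_eq using rv by (intro measurable_restrict) (auto simp: measurable_cong_sets[OF refl sets_unif])
  have "distr N (PiM (F \<times> W) (\<lambda>_. borel)) (\<lambda>\<omega>. \<lambda>p\<in>F \<times> W. ?X p \<omega>)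
      = PiM (F \<times> W) (\<lambda>p. distr N borel (?X p))"
    using indep_vars_iff_distr_eq_PiM'[OF ne, of ?X "\<lambda>_. borel"] indep rv by simp
  also have "\<dots> = PiM (F \<times> W) (\<lambda>_. unif)"
    using distr by (intro PiM_cong) auto
  also have "distr N (PiM (F \<times> W) (\<lambda>_. borel)) (\<lambda>\<omega>. \<lambda>p\<in>F \<times> W. ?X p \<omega>)
      = distr N (PiM (F \<times> W) (\<lambda>_. unif)) (\<lambda>\<omega>. \<lambda>(f, w)\<in>F \<times> W. \<alpha> \<omega> f w)"
    using sets by (intro distr_cong) (auto simp: X_eq)
  finally show "distr N (PiM (F \<times> W) (\<lambda>_. unif)) (\<lambda>\<omega>. \<lambda>(f, w)\<in>F \<times> W. \<alpha> \<omega> f w) = PiM (F \<times> W) (\<lambda>_. unif)" .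
qed

text \<open>
  Truncating the entries at 0 does not change any coalition value, so the formula for the salaries
  holds at every sample point, not just almost everywhere; hence their sum is measurable.
\<close>
lemma iid_uniform_matrix_expectation:
  fixes F :: "'f set" and W :: "nat set"
  assumes N: "prob_space N" and iid_N: "iid_uniform_matrix N F W \<alpha>"
    and fin: "finite F" "finite W" and card: "card F = card W" and ne: "W \<noteq> {}"
    and opt: "\<And>\<omega>. \<omega> \<in> space N \<Longrightarrow> firm_optimal_core_allocation F W (\<alpha> \<omega>) (\<mu> \<omega>, u \<omega>, v \<omega>)"
  shows "integrable N (\<lambda>\<omega>. \<Sum>w\<in>W. v \<omega> w)"
    and "(\<integral>\<omega>. (\<Sum>w\<in>W. v \<omega> w) \<partial>N) = iid_prob.expectation (\<lambda>\<omega>. total_salary \<omega> F W)"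
proof -
  have "F \<noteq> {}" using card ne fin by auto
  hence FW: "F \<times> W \<noteq> {}" using ne by auto
  define G where "G c = total_salary (\<lambda>p. max 0 (c p)) F W" for c :: "'f \<times> nat \<Rightarrow> real"
  let ?P = "PiM (F \<times> W) (\<lambda>_. unif)"
  let ?X = "\<lambda>\<omega>. \<lambda>(f, w)\<in>F \<times> W. \<alpha> \<omega> f w"
  have entry: "(\<lambda>\<omega>. \<omega> p) \<in> borel_measurable ?P" if "p \<in> F \<times> W" for p
    using measurable_component_singleton[OF that, of "\<lambda>_. unif"] by (simp cong: measurable_cong_sets)
  have G: "G \<in> borel_measurable ?P"
    unfolding G_def total_salary_def using fin
    by (intro borel_measurable_diff borel_measurable_sum measurable_opt_value measurable_marginal
        borel_measurable_max borel_measurable_const entry) auto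
  have restr: "(\<lambda>\<omega>. restrict \<omega> (F \<times> W)) \<in> measurable iid ?P"
    unfolding iid_def by (intro measurable_restrict_subset) auto
  have P: "?P = distr iid ?P (\<lambda>\<omega>. restrict \<omega> (F \<times> W))"
    unfolding iid_def using fin by (intro iid.distr_PiM_restrict_finite[symmetric]) auto
  \<comment> \<open>Canonical entries are almost surely positive, so the truncation in
    \<open>G\<close> is invisible in the expectation.\<close>
  have G_AE: "AE \<omega> in iid. G (restrict \<omega> (F \<times> W)) = total_salary \<omega> F W"
    using AE_entries[OF fin]
  proof eventually_elim
    case (elim \<omega>)
    show ?case unfolding G_def
    proof (rule total_salary_cong)
      fix f w assume fw: "f \<in> F" "w \<in> W"
      hence "0 < \<omega> (f, w)" using elim by blast
      thus "max 0 (restrict \<omega> (F \<times> W) (f, w)) = \<omega> (f, w)" using fw by simp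
    qed
  qed
  have v: "(\<Sum>w\<in>W. v \<omega> w) = G (?X \<omega>)" if "\<omega> \<in> space N" for \<omega>
    unfolding firm_optimal_total_salary[OF fin card opt[OF that]] G_def
    by (intro total_salary_cong) auto
  note X = iid_uniform_matrix_distr[OF N iid_N FW]
  have Gm: "(\<lambda>\<omega>. G (restrict \<omega> (F \<times> W))) \<in> borel_measurable iid"
    by (rule measurable_compose[OF restr G])
  have Tm: "(\<lambda>\<omega>. total_salary \<omega> F W) \<in> borel_measurable iid"
    using integrable_total_salary[OF fin card] by (rule borel_measurable_integrable)
  have "integrable iid (\<lambda>\<omega>. G (restrict \<omega> (F \<times> W)))"
    using integrable_total_salary[OF fin card] integrable_cong_AE[OF Gm Tm G_AE] by simp
  hence "integrable ?P G"
    by (subst P) (simp add: integrable_distr_eq[OF restr G])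
  hence "integrable N (\<lambda>\<omega>. G (?X \<omega>))"
    using integrable_distr_eq[OF X(1) G] X(2) by simp
  thus "integrable N (\<lambda>\<omega>. \<Sum>w\<in>W. v \<omega> w)"
    by (subst Bochner_Integration.integrable_cong[OF refl v]) auto
  have "(\<integral>\<omega>. (\<Sum>w\<in>W. v \<omega> w) \<partial>N) = (\<integral>\<omega>. G (?X \<omega>) \<partial>N)"
    by (intro Bochner_Integration.integral_cong refl v)
  also have "\<dots> = (\<integral>\<omega>. G \<omega> \<partial>?P)"
    using integral_distr[OF X(1) G] X(2) by simp
  also have "\<dots> = iid_prob.expectation (\<lambda>\<omega>. G (restrict \<omega> (F \<times> W)))"
    by (subst P) (rule integral_distr[OF restr G])
  also have "\<dots> = iid_prob.expectation (\<lambda>\<omega>. total_salary \<omega> F W)"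
    by (rule integral_cong_AE[OF Gm Tm G_AE])
  finally show "(\<integral>\<omega>. (\<Sum>w\<in>W. v \<omega> w) \<partial>N) = iid_prob.expectation (\<lambda>\<omega>. total_salary \<omega> F W)" .
qed

theorem theorem8:
  fixes M :: "nat \<Rightarrow> 'a measure"
    and F :: "nat \<Rightarrow> 'f set"
    and \<alpha> :: "nat \<Rightarrow> 'a \<Rightarrow> 'f \<Rightarrow> nat \<Rightarrow> real"
    and \<mu> :: "nat \<Rightarrow> 'a \<Rightarrow> ('f \<times> nat) set"
    and u :: "nat \<Rightarrow> 'a \<Rightarrow> 'f \<Rightarrow> real"
    and v :: "nat \<Rightarrow> 'a \<Rightarrow> nat \<Rightarrow> real"
  assumes "\<And>n. n \<ge> 1 \<Longrightarrow> finite (F n) \<and> card (F n) = n"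
    and "\<And>n. n \<ge> 1 \<Longrightarrow> prob_space (M n)"
    and "\<And>n. n \<ge> 1 \<Longrightarrow> iid_uniform_matrix (M n) (F n) {1..n} (\<alpha> n)"
    and "\<And>n \<omega>. n \<ge> 1 \<Longrightarrow> \<omega> \<in> space (M n) \<Longrightarrow>
           firm_optimal_core_allocation (F n) {1..n} (\<alpha> n \<omega>) (\<mu> n \<omega>, u n \<omega>, v n \<omega>)"
  shows "(\<forall>n\<ge>1. integrable (M n) (\<lambda>\<omega>. \<Sum>i\<in>{1..n}. v n \<omega> i) \<and>
            prob_space.expectation (M n) (\<lambda>\<omega>. \<Sum>i\<in>{1..n}. v n \<omega> i) \<le> ln (real n)) \<and>
         (\<lambda>n. prob_space.expectation (M n) (\<lambda>\<omega>. \<Sum>i\<in>{1..n}. v n \<omega> i)) \<in> \<Omega>(\<lambda>n. ln (real n))"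
proof
  have F: "finite (F n)" "card (F n) = n" if "1 \<le> n" for n using assms(1) that by auto
  have int: "integrable (M n) (\<lambda>\<omega>. \<Sum>i\<in>{1..n}. v n \<omega> i)"
    and exp: "(\<integral>\<omega>. (\<Sum>i\<in>{1..n}. v n \<omega> i) \<partial>M n) = iid_prob.expectation (\<lambda>\<omega>. total_salary \<omega> (F n) {1..n})"
    if n: "1 \<le> n" for n
    using iid_uniform_matrix_expectation[OF assms(2,3)[OF n] F(1)[OF n] _ _ _ assms(4)[OF n]] F(2)[OF n] n
    by auto
  have up: "iid_prob.expectation (\<lambda>\<omega>. total_salary \<omega> (F n) {1..n}) \<le> ln (real n)" if "1 \<le> n" for n
    using F that by (intro expectation_total_salary_le_ln) auto
  have low: "ln (real n) / 256 * (1 - sqrt (real n) / real (n + 1) - 256 * ln (real n) / real n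
      - real n * (1 / 4) ^ n) - 2 \<le> iid_prob.expectation (\<lambda>\<omega>. total_salary \<omega> (F n) {1..n})"
    if "1 \<le> n" for n
    using F that by (intro expectation_total_salary_ge) auto
  show "\<forall>n\<ge>1. integrable (M n) (\<lambda>\<omega>. \<Sum>i\<in>{1..n}. v n \<omega> i) \<and>
      prob_space.expectation (M n) (\<lambda>\<omega>. \<Sum>i\<in>{1..n}. v n \<omega> i) \<le> ln (real n)"
    using int exp up by simp
  show "(\<lambda>n. prob_space.expectation (M n) (\<lambda>\<omega>. \<Sum>i\<in>{1..n}. v n \<omega> i)) \<in> \<Omega>(\<lambda>n. ln (real n))"
  proof (rule landau_omega.bigI[of "1 / 1024"])
    show "\<forall>\<^sub>F n in sequentially. 1 / 1024 * norm (ln (real n))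
        \<le> norm (prob_space.expectation (M n) (\<lambda>\<omega>. \<Sum>i\<in>{1..n}. v n \<omega> i))"
      using eventually_lower_bound eventually_ge_at_top[of 1]
    proof eventually_elim
      case (elim n)
      have "ln (real n) / 1024 \<le> iid_prob.expectation (\<lambda>\<omega>. total_salary \<omega> (F n) {1..n})"
        using elim(1) low[OF elim(2)] by linarith
      moreover have "0 \<le> ln (real n)" using elim(2) by simp
      ultimately show ?case using exp[OF elim(2)] by simp
    qed
  qed simp
qed

end
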